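(* Let $A$ be an algebra over a field $\mathbb{F}\neq\{0,1\}$ (that is, $\mathbb{F}$ has more than two elements) such that every commutator in $A$ is a sum of square-zero elements, and such that every proper ideal of $A$ is contained in a non-exceptional prime ideal. Let $V\subseteq A$ be a fully noncentral subspace. Then the following are equivalent: (1) $V$ is invariant under all inner automorphisms of $A$. (2) $V$ is invariant under all inner automorphisms induced by square-zero elements of $A$, that is, $(1+x)a(1-x)\in V$ for all $a\in V$ and all $x\in A$ with $x^2=0$. (3) $[A,A]\subseteq V$. (4) $V$ is a Lie ideal in $A$. (5) $V$ is an $[A,A]$-submodule.
   Context: Rings and algebras are associative and not necessarily unital; ideals are two-sided. $[x,y]=xy-yx$. For subsets $G,H$ of a ring $A$, at least one of which is an additive subgroup, $[G,H]$ is the additive subgroup generated by all $[g,h]$ with $g\in G$, $h\in H$. A subset of $A$ is full if it is not contained in a proper ideal of $A$. A subset $X\subseteq A$ is fully noncentral if $[A,X]$ is full. An additive subgroup $V$ is a Lie ideal if $[A,V]\subseteq V$, and it is an $[A,A]$-submodule if $[[A,A],V]\subseteq V$. The minimal unitization $\widetilde{A}$ is $A$ if $A$ is unital, and otherwise $\mathbb{Z}\times A$ with coordinatewise addition and multiplication $(m,x)(n,y)=(mn,my+nx+xy)$, in which $A$ is an ideal via $x\mapsto(0,x)$. An automorphism of $A$ is inner if it has the form $a\mapsto vav^{-1}$ for some invertible $v\in\widetilde{A}$. A subset $V$ is invariant under $\alpha$ if $\alpha(V)\subseteq V$. A square-zero element is an $x\in A$ with $x^2=0$. Prime ideals are proper,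 and an ideal $P$ is prime if and only if $A/P$ is a (nonzero) prime ring. A prime ring $S$ is exceptional if it has characteristic $2$ (i.e. $2x=0$ for all $x\in S$) and satisfies the polynomial identity $s_4$, where $s_4(x_1,\ldots,x_4)=\sum_{\sigma\in S_4}\mathrm{sign}(\sigma)x_{\sigma(1)}x_{\sigma(2)}x_{\sigma(3)}x_{\sigma(4)}$. A prime ideal $P$ of $A$ is exceptional if the prime ring $A/P$ is exceptional; otherwise it is non-exceptional. *)

theory Defs
  imports
    Complex_Main
    "HOL-Computational_Algebra.Group_Closure"
    "HOL-Combinatorics.Permutations"
    "HOL-Algebra.QuotRing"
begin

text \<open>
  The algebra itself is the whole of a type of class \<open>ring\<close>, which is associative and not
  necessarily unital. Ring records are used only for the structures derived from it (quotients and
  the minimal unitization).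
\<close>

locale algebra_over_field = vector_space scale
  for scale :: "'f::field \<Rightarrow> 'a::ring \<Rightarrow> 'a" +
  assumes scale_mult_left: "scale c x * y = scale c (x * y)"
    and scale_mult_right: "x * scale c y = scale c (x * y)"


section \<open>Ideals, quotients and exceptional primes\<close>

text \<open>
  Rings without a unit are represented by ring records whose \<open>one\<close> component is meaningless; no
  definition in this section, and neither the carrier, sum nor product of \<open>R Quot I\<close>, refers to it.
\<close>

definition univ_ring :: "'a::ring ring" where
  "univ_ring = \<lparr>carrier = UNIV, monoid.mult = (*), one = undefined, ring.zero = 0, add = (+)\<rparr>"

text \<open>The locale \<open>ideal\<close> of the library is not usable here, as it presupposes a unital ring.\<close>

definition two_sided_ideal :: "('a, 'm) ring_scheme \<Rightarrow> 'a set \<Rightarrow> bool" where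
  "two_sided_ideal R I \<longleftrightarrow> additive_subgroup I R \<and>
     (\<forall>a\<in>carrier R. \<forall>x\<in>I. a \<otimes>\<^bsub>R\<^esub> x \<in> I \<and> x \<otimes>\<^bsub>R\<^esub> a \<in> I)"

definition proper_ideal :: "('a, 'm) ring_scheme \<Rightarrow> 'a set \<Rightarrow> bool" where
  "proper_ideal R I \<longleftrightarrow> two_sided_ideal R I \<and> I \<noteq> carrier R"

definition prime_ideal :: "('a, 'm) ring_scheme \<Rightarrow> 'a set \<Rightarrow> bool" where
  "prime_ideal R P \<longleftrightarrow> proper_ideal R P \<and>
     (\<forall>I J. two_sided_ideal R I \<longrightarrow> two_sided_ideal R J \<longrightarrow>
        (\<forall>x\<in>I. \<forall>y\<in>J. x \<otimes>\<^bsub>R\<^esub> y \<in> P) \<longrightarrow> I \<subseteq> P \<or> J \<subseteq> P)"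

text \<open>Since prime ideals are proper, prime rings are nonzero.\<close>

definition prime_ring :: "('a, 'm) ring_scheme \<Rightarrow> bool" where
  "prime_ring R \<longleftrightarrow> prime_ideal R {\<zero>\<^bsub>R\<^esub>}"

definition s4 :: "('a, 'm) ring_scheme \<Rightarrow> (nat \<Rightarrow> 'a) \<Rightarrow> 'a" where
  "s4 R x = (\<Oplus>\<^bsub>R\<^esub>\<sigma>\<in>{\<sigma>. \<sigma> permutes {1..4}}.
     [sign \<sigma>] \<cdot>\<^bsub>R\<^esub> (x (\<sigma> 1) \<otimes>\<^bsub>R\<^esub> x (\<sigma> 2) \<otimes>\<^bsub>R\<^esub> x (\<sigma> 3) \<otimes>\<^bsub>R\<^esub> x (\<sigma> 4)))"

definition exceptional_ring :: "('a, 'm) ring_scheme \<Rightarrow> bool" where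
  "exceptional_ring R \<longleftrightarrow> prime_ring R \<and>
     (\<forall>x\<in>carrier R. x \<oplus>\<^bsub>R\<^esub> x = \<zero>\<^bsub>R\<^esub>) \<and>
     (\<forall>x. (\<forall>i\<in>{1..4}. x i \<in> carrier R) \<longrightarrow> s4 R x = \<zero>\<^bsub>R\<^esub>)"

definition exceptional_prime_ideal :: "'a::ring set \<Rightarrow> bool" where
  "exceptional_prime_ideal P \<longleftrightarrow>
     prime_ideal univ_ring P \<and> exceptional_ring (univ_ring Quot P)"

definition nonexceptional_prime_ideal :: "'a::ring set \<Rightarrow> bool" where
  "nonexceptional_prime_ideal P \<longleftrightarrow>
     prime_ideal univ_ring P \<and> \<not> exceptional_prime_ideal P"


section \<open>Commutators and Lie ideals\<close>

definition commutator :: "'a::ring \<Rightarrow> 'a \<Rightarrow> 'a" where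
  "commutator x y = x * y - y * x"

definition commutator_subgroup :: "'a::ring set \<Rightarrow> 'a set \<Rightarrow> 'a set" where
  "commutator_subgroup G H = group_closure {commutator g h |g h. g \<in> G \<and> h \<in> H}"

definition square_zero :: "'a::ring \<Rightarrow> bool" where
  "square_zero x \<longleftrightarrow> x * x = 0"

definition full :: "'a::ring set \<Rightarrow> bool" where
  "full X \<longleftrightarrow> \<not> (\<exists>I. proper_ideal univ_ring I \<and> X \<subseteq> I)"

definition fully_noncentral :: "'a::ring set \<Rightarrow> bool" where
  "fully_noncentral X \<longleftrightarrow> full (commutator_subgroup UNIV X)"

definition lie_ideal :: "'a::ring set \<Rightarrow> bool" where
  "lie_ideal V \<longleftrightarrow> additive_subgroup V univ_ring \<and> commutator_subgroup UNIV V \<subseteq> V"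

definition commutator_submodule :: "'a::ring set \<Rightarrow> bool" where
  "commutator_submodule V \<longleftrightarrow> additive_subgroup V univ_ring \<and>
     commutator_subgroup (commutator_subgroup UNIV UNIV) V \<subseteq> V"


section \<open>The minimal unitization and inner automorphisms\<close>

definition is_unit_element :: "'a::ring \<Rightarrow> bool" where
  "is_unit_element e \<longleftrightarrow> (\<forall>x. e * x = x \<and> x * e = x)"

text \<open>
  If the algebra is unital, it is identified with the copy \<open>{0} \<times> UNIV\<close> of itself in
  \<open>\<int> \<times> UNIV\<close>, so that in both cases the embedding into the unitization is \<open>x \<mapsto> (0, x)\<close>.
\<close>

definition min_unitization :: "(int \<times> 'a::ring) ring" where
  "min_unitization =
    \<lparr>carrier = (if \<exists>e::'a. is_unit_element e then {0} \<times> UNIV else UNIV),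
     monoid.mult = (\<lambda>(m, x) (n, y).
       (m * n, [m] \<cdot>\<^bsub>univ_ring\<^esub> y + [n] \<cdot>\<^bsub>univ_ring\<^esub> x + x * y)),
     one = (if \<exists>e::'a. is_unit_element e then (0, THE e. is_unit_element e) else (1, 0)),
     ring.zero = (0, 0),
     add = (\<lambda>(m, x) (n, y). (m + n, x + y))\<rparr>"

definition unitization_embed :: "'a::ring \<Rightarrow> int \<times> 'a" where
  "unitization_embed x = (0, x)"

text \<open>
  The image of the embedding is an ideal, so every unit \<open>v\<close> determines a unique map \<open>\<alpha>\<close>, which is
  then an automorphism.
\<close>

definition inner_automorphism :: "('a::ring \<Rightarrow> 'a) \<Rightarrow> bool" where
  "inner_automorphism \<alpha> \<longleftrightarrow>
     (\<exists>v\<in>Units (min_unitization :: (int \<times> 'a) ring). \<forall>a. unitization_embed (\<alpha> a) =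
        v \<otimes>\<^bsub>min_unitization\<^esub> unitization_embed a \<otimes>\<^bsub>min_unitization\<^esub> inv\<^bsub>min_unitization\<^esub> v)"

definition invariant_under :: "('a \<Rightarrow> 'a) \<Rightarrow> 'a set \<Rightarrow> bool" where
  "invariant_under \<alpha> V \<longleftrightarrow> \<alpha> ` V \<subseteq> V"

definition square_zero_conjugate :: "'a::ring \<Rightarrow> 'a \<Rightarrow> int \<times> 'a" where
  "square_zero_conjugate x a =
     (\<one>\<^bsub>min_unitization\<^esub> \<oplus>\<^bsub>min_unitization\<^esub> unitization_embed x)
       \<otimes>\<^bsub>min_unitization\<^esub> unitization_embed a
       \<otimes>\<^bsub>min_unitization\<^esub> (\<one>\<^bsub>min_unitization\<^esub> \<ominus>\<^bsub>min_unitization\<^esub> unitization_embed x)"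

definition inner_invariant :: "'a::ring set \<Rightarrow> bool" where
  "inner_invariant V \<longleftrightarrow> (\<forall>\<alpha>. inner_automorphism \<alpha> \<longrightarrow> invariant_under \<alpha> V)"

definition square_zero_invariant :: "'a::ring set \<Rightarrow> bool" where
  "square_zero_invariant V \<longleftrightarrow>
     (\<forall>x. square_zero x \<longrightarrow> (\<forall>a\<in>V. square_zero_conjugate x a \<in> unitization_embed ` V))"

end

theory Submission
  imports Defs
begin

text \<open>
  The hard implication is (5) \<open>\<Longrightarrow>\<close> (3). If \<open>V\<close> is an \<open>[A,A]\<close>-submodule, then so is
  \<open>T = {x. [x,A] \<subseteq> V}\<close>, which is moreover a subring and contains \<open>[V,V]\<close>; and if \<open>[u,A] \<subseteq> T\<close> and
  \<open>v \<in> T\<close>, then the ideal generated by \<open>[u,v]\<close> lies in \<open>T\<close>. Let \<open>I\<close> be the largest ideal inside \<open>T\<close>.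
  If \<open>I\<close> is proper, it lies in a non-exceptional prime \<open>P\<close>, and \<open>[[T,T],T]\<close> vanishes modulo \<open>P\<close>.
  In a non-exceptional prime ring a \<open>[R,R]\<close>-submodule whose commutators are central is itself
  central; applied to the center of \<open>T\<close>, to \<open>T\<close> and to \<open>V\<close> this shows that \<open>V\<close> is central modulo
  \<open>P\<close>, so \<open>V\<close> is not fully noncentral. Hence \<open>T = A\<close>.

  The statement about prime rings is elementary if \<open>2\<close> is not a zero divisor. In characteristic \<open>2\<close>
  all \<open>a \<in> V\<close> have central squares, so \<open>D = [a,-]\<close> satisfies \<open>D\<^sup>2 = 0\<close>. If \<open>V\<close> is not abelian, two of
  its elements generate a quaternion algebra over the center that spans the ring. If \<open>V\<close> is abelian,
  then \<open>a\<close> can be chosen such that \<open>D(R)\<close> is commutative and contains an element with nonzero central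
  fourth power; then the kernel of \<open>D\<close> has rank \<open>2\<close> and the ring has rank \<open>4\<close> over the center. In
  both cases \<open>s\<^sub>4\<close> vanishes, because it is alternating and vanishes if one argument is central.

  For (2) \<open>\<Longrightarrow>\<close> (5), scaling a square-zero element \<open>x\<close> separates the linear part \<open>[x,a]\<close> of
  \<open>(1+x)a(1-x)\<close> from the quadratic part \<open>xax\<close>. For (3) \<open>\<Longrightarrow>\<close> (1), \<open>vav\<inverse> - a = [va, v\<inverse>]\<close>.
\<close>

section \<open>Commutators and central elements\<close>

definition central :: "'a::ring \<Rightarrow> bool" where
  "central c \<longleftrightarrow> (\<forall>x. c * x = x * c)"

lemma centralD: "central c \<Longrightarrow> c * x = x * c"
  by (simp add: central_def)

lemma central_iff_commutator: "central c \<longleftrightarrow> (\<forall>x. commutator c x = 0)"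
  by (simp add: central_def commutator_def)

lemma central_0 [simp]: "central 0"
  and central_add: "central b \<Longrightarrow> central c \<Longrightarrow> central (b + c)"
  and central_minus_iff [simp]: "central (- c) \<longleftrightarrow> central c"
  by (auto simp: central_def algebra_simps)

lemma central_mult: "central b \<Longrightarrow> central c \<Longrightarrow> central (b * c)"
  unfolding central_def by (metis mult.assoc)

lemma commutator_add_left: "commutator (a + b) x = commutator a x + commutator b x"
  and commutator_add_right: "commutator a (x + y) = commutator a x + commutator a y"
  and commutator_diff_left: "commutator (a - b) x = commutator a x - commutator b x"
  and commutator_diff_right: "commutator a (x - y) = commutator a x - commutator a y"
  and commutator_minus_left [simp]: "commutator (- a) x = - commutator a x"
  and commutator_minus_right [simp]: "commutator a (- x) = - commutator a x"
  and commutator_0_left [simp]: "commutator 0 x = 0"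
  and commutator_0_right [simp]: "commutator a 0 = 0"
  and commutator_self [simp]: "commutator a a = 0"
  by (simp_all add: commutator_def algebra_simps)

lemma commutator_mult_right: "commutator a (x * y) = commutator a x * y + x * commutator a y"
  and commutator_mult_left: "commutator (x * y) a = x * commutator y a + commutator x a * y"
  by (simp_all add: commutator_def algebra_simps)

lemma commutator_swap: "commutator x y = - commutator y x"
  by (simp add: commutator_def)

lemma commutator_eq_0_iff: "commutator x y = 0 \<longleftrightarrow> x * y = y * x"
  by (simp add: commutator_def)

lemma commutator_central_left: "central c \<Longrightarrow> commutator c x = 0"
  and commutator_central_right: "central c \<Longrightarrow> commutator x c = 0"
  by (simp_all add: commutator_def central_def)

lemma commutator_jacobi:
  "commutator a (commutator x y) = commutator (commutator a x) y + commutator x (commutator a y)"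
  by (simp add: commutator_def algebra_simps)

section \<open>Additive subgroups and submodules in elementwise form\<close>

lemma additive_subgroup_univ_ring_iff:
  "additive_subgroup V (univ_ring :: 'a::ring ring) \<longleftrightarrow> 0 \<in> V \<and> (\<forall>x\<in>V. \<forall>y\<in>V. x - y \<in> V)"
proof -
  interpret G: group "add_monoid (univ_ring :: 'a ring)"
  proof (rule groupI)
    show "\<exists>y\<in>carrier (add_monoid univ_ring). y \<otimes>\<^bsub>add_monoid univ_ring\<^esub> x = \<one>\<^bsub>add_monoid univ_ring\<^esub>"
      for x :: 'a
      by (rule bexI[of _ "- x"]) (simp_all add: univ_ring_def)
  qed (simp_all add: univ_ring_def add.assoc)
  have inv: "inv\<^bsub>add_monoid (univ_ring :: 'a ring)\<^esub> x = - x" for x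
    by (rule G.inv_equality) (simp_all add: univ_ring_def)
  show ?thesis
  proof
    assume "additive_subgroup V (univ_ring :: 'a ring)"
    then interpret H: additive_subgroup V "univ_ring :: 'a ring" .
    show "0 \<in> V \<and> (\<forall>x\<in>V. \<forall>y\<in>V. x - y \<in> V)"
    proof (intro conjI ballI)
      show "0 \<in> V" using H.zero_closed by (simp add: univ_ring_def)
      fix x y assume "x \<in> V" "y \<in> V"
      then have "x \<oplus>\<^bsub>univ_ring\<^esub> (- y) \<in> V"
        using subgroup.m_inv_closed[OF H.a_subgroup, of y] unfolding inv by (intro H.a_closed)
      then show "x - y \<in> V" by (simp add: univ_ring_def)
    qed
  next
    assume V: "0 \<in> V \<and> (\<forall>x\<in>V. \<forall>y\<in>V. x - y \<in> V)"
    then have neg: "- x \<in> V" if "x \<in> V" for x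
      using that by (metis diff_0)
    have add: "x + y \<in> V" if "x \<in> V" "y \<in> V" for x y
      using V neg[OF that(2)] that(1) by (metis diff_minus_eq_add)
    show "additive_subgroup V (univ_ring :: 'a ring)"
      proof (intro additive_subgroup.intro G.subgroupI)
      show "V \<noteq> {}" using V by blast
      show "inv\<^bsub>add_monoid univ_ring\<^esub> x \<in> V" if "x \<in> V" for x
        unfolding inv by (rule neg[OF that])
    qed (use add in \<open>simp_all add: univ_ring_def\<close>)
  qed
qed

lemma group_closure_subset_iff:
  assumes "0 \<in> V" "\<And>x y. x \<in> V \<Longrightarrow> y \<in> V \<Longrightarrow> x - y \<in> V"
  shows "group_closure S \<subseteq> V \<longleftrightarrow> S \<subseteq> V"
proof
  assume S: "S \<subseteq> V"
  have "x \<in> V" if "x \<in> group_closure S" for x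
    using that by induction (use S assms in auto)
  then show "group_closure S \<subseteq> V" by blast
qed (meson group_closure.base insertI2 subset_iff)

lemma commutator_subgroup_subset_iff:
  assumes "0 \<in> V" "\<And>x y. x \<in> V \<Longrightarrow> y \<in> V \<Longrightarrow> x - y \<in> V"
  shows "commutator_subgroup G H \<subseteq> V \<longleftrightarrow> (\<forall>g\<in>G. \<forall>h\<in>H. commutator g h \<in> V)"
  unfolding commutator_subgroup_def using group_closure_subset_iff[OF assms] by auto

text \<open>The elements \<open>l\<close> with [l,V] \<subseteq> V form an additive subgroup, so
  they include [A,A] as soon as they include every single commutator.\<close>

lemma commutator_submodule_iff:
  "commutator_submodule V \<longleftrightarrow> 0 \<in> V \<and> (\<forall>x\<in>V. \<forall>y\<in>V. x - y \<in> V) \<and>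
     (\<forall>x y. \<forall>v\<in>V. commutator (commutator x y) v \<in> V)"
proof (cases "0 \<in> V \<and> (\<forall>x\<in>V. \<forall>y\<in>V. x - y \<in> V)")
  case True
  then have V: "0 \<in> V" "\<And>x y. x \<in> V \<Longrightarrow> y \<in> V \<Longrightarrow> x - y \<in> V" by blast+
  let ?S = "{l. \<forall>v\<in>V. commutator l v \<in> V}"
  have "commutator_subgroup UNIV UNIV \<subseteq> ?S \<longleftrightarrow> (\<forall>g\<in>UNIV. \<forall>h\<in>UNIV. commutator g h \<in> ?S)"
    by (rule commutator_subgroup_subset_iff) (simp_all add: V commutator_diff_left)
  moreover have "commutator_subgroup (commutator_subgroup UNIV UNIV) V \<subseteq> V \<longleftrightarrow>
      (\<forall>l\<in>commutator_subgroup UNIV UNIV. \<forall>v\<in>V. commutator l v \<in> V)"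
    by (rule commutator_subgroup_subset_iff) (rule V; assumption)+
  ultimately show ?thesis
    unfolding commutator_submodule_def additive_subgroup_univ_ring_iff using True
    by (simp add: subset_iff Ball_def)
next
  case False
  then show ?thesis
    unfolding commutator_submodule_def additive_subgroup_univ_ring_iff by blast
qed

lemma commutator_submoduleD:
  assumes "commutator_submodule V"
  shows "0 \<in> V"
    and "x \<in> V \<Longrightarrow> y \<in> V \<Longrightarrow> x - y \<in> V"
    and "x \<in> V \<Longrightarrow> y \<in> V \<Longrightarrow> x + y \<in> V"
    and "x \<in> V \<Longrightarrow> - x \<in> V"
    and "v \<in> V \<Longrightarrow> commutator (commutator x y) v \<in> V"
    and "v \<in> V \<Longrightarrow> commutator v (commutator x y) \<in> V"
proof -
  note V = assms[unfolded commutator_submodule_iff]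
  show "0 \<in> V" using V by blast
  show "x - y \<in> V" if "x \<in> V" "y \<in> V" for x y using V that by blast
  show neg: "- x \<in> V" if "x \<in> V" for x using V that by (metis diff_0)
  show "x + y \<in> V" if "x \<in> V" "y \<in> V"
    using V neg[OF that(2)] that(1) by (metis diff_minus_eq_add)
  show lie: "commutator (commutator x y) v \<in> V" if "v \<in> V" for v x y using V that by blast
  show "commutator v (commutator x y) \<in> V" if "v \<in> V"
    using neg[OF lie[OF that]] by (metis commutator_swap)
qed


text \<open>The zero ring is included, so that a quotient by an improper ideal is an instance as well.\<close>

class prime_rng = ring +
  assumes prime_rng: "(\<And>r. x * r * y = 0) \<Longrightarrow> x = 0 \<or> y = 0"

lemma central_mult_eq_0:
  fixes c :: "'a::prime_rng"
  assumes "central c" "c * x = 0"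
  shows "c = 0 \<or> x = 0"
  by (rule prime_rng) (metis assms centralD mult.assoc mult_zero_right)

text \<open>As [cx,y] = c[x,y] for central c, centrality of cx forces c[x,y] = 0 for all y.\<close>

lemma central_mult_central:
  fixes c :: "'a::prime_rng"
  assumes "central c" "central (c * x)"
  shows "c = 0 \<or> central x"
proof -
  have "c * commutator x y = 0" for y
    using commutator_mult_left[of c x y] assms by (simp add: commutator_central_left)
  then show ?thesis
    using central_mult_eq_0[OF assms(1)] unfolding central_iff_commutator by blast
qed

section \<open>Prime rings without 2-torsion\<close>

text \<open>For z = [a,b], the derivation [a,-] sends b to z and kills a and z, so [a,[a,b^2 a^2]] =
  2 z^2 a^2; applying [b,-] gives -4 z^3 a. This is a commutator of two elements of V, hence
  central, so 4 z^3 = 0 or a is central.\<close>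

lemma commutator_submodule_abelian_if_torsion_free:
  fixes a b :: "'a::prime_rng"
  assumes V: "commutator_submodule V" and a: "a \<in> V" and b: "b \<in> V"
    and cent: "\<And>a b. a \<in> V \<Longrightarrow> b \<in> V \<Longrightarrow> central (commutator a b)"
    and torsion_free: "\<And>x :: 'a. x + x = 0 \<Longrightarrow> x = 0"
  shows "commutator a b = 0"
proof -
  define z where "z = commutator a b"
  have z: "z * x = x * z" for x using cent[OF a b] by (simp add: z_def centralD)
  have zc: "a * z = z * a" "b * z = z * b" by (simp_all only: z)
  have zl: "a * (z * y) = z * (a * y)" "b * (z * y) = z * (b * y)" for y
    by (metis mult.assoc z)+
  have az: "commutator a z = 0" "commutator b z = 0"
    by (simp_all add: commutator_def z)
  have ab: "commutator a b = z" "commutator b a = - z"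
    by (simp_all add: z_def commutator_def)
  have "commutator b (commutator a (commutator a (b * b * a * a))) =
      - (z * z * z * a + z * z * z * a + z * z * z * a + z * z * z * a)"
    by (simp add: commutator_mult_right commutator_add_right ab az algebra_simps zc zl)
  moreover have "central (commutator b (commutator a (commutator a (b * b * a * a))))"
    by (intro cent b commutator_submoduleD(6)[OF V] a)
  moreover have "z * z * z * a + z * z * z * a + z * z * z * a + z * z * z * a
      = (z * z * z + z * z * z + z * z * z + z * z * z) * a"
    by (simp add: algebra_simps)
  ultimately have "central ((z * z * z + z * z * z + z * z * z + z * z * z) * a)"
    by (metis central_minus_iff)
  moreover have cz: "central z" by (simp add: central_def z)
  moreover have "central (z * z * z + z * z * z + z * z * z + z * z * z)"
    by (intro central_add central_mult cz)
  ultimately have "z * z * z + z * z * z + z * z * z + z * z * z = 0 \<or> central a"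
    using central_mult_central by blast
  then show ?thesis
  proof
    assume "z * z * z + z * z * z + z * z * z + z * z * z = 0"
    then have "z * (z * z) = 0"
      using torsion_free[of "z * z * z"] torsion_free[of "z * z * z + z * z * z"]
      by (simp add: add.assoc mult.assoc)
    then show ?thesis
      using central_mult_eq_0[OF cz] z_def by blast
  next
    assume "central a"
    then show ?thesis by (simp add: commutator_central_left)
  qed
qed

text \<open>The derivation D = [a,-] is killed in two stages, first D^2 = 0 and then D = 0. Each
  stage derives a product with an arbitrary middle factor, to which primeness applies.\<close>

lemma central_if_torsion_free:
  fixes a :: "'a::prime_rng"
  assumes nil: "\<And>x y. commutator a (commutator a (commutator x y)) = 0"
    and torsion_free: "\<And>x :: 'a. x + x = 0 \<Longrightarrow> x = 0"
  shows "central a"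
proof -
  define D where "D = commutator a"
  have D_mult: "D (x * y) = D x * y + x * D y" for x y
    by (simp add: D_def commutator_mult_right)
  have D_add: "D (x + y) = D x + D y" and D_diff: "D (x - y) = D x - D y" for x y
    by (simp_all add: D_def commutator_add_right commutator_diff_right)
  have D3: "D (D (D x)) = 0" for x
    using nil by (simp add: D_def)
  have Da: "D a = 0" by (simp add: D_def)
  have xa: "x * a = a * x - D x" for x
    by (simp add: D_def commutator_def)
  have e0: "D (D (x * y - y * x)) = 0" for x y
    using nil[of x y] unfolding D_def commutator_def[of x y] .
  have e1: "D y * D (D x) + D y * D (D x) + D (D y) * D x = 0" for x y
  proof -
    \<comment> \<open>Replacing y by ya in D^2[x,y] = 0 and subtracting the old identity times a
      leaves only commutators with a, each of which is one more D up to sign.\<close>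
    have "D (D (x * (y * a) - (y * a) * x)) - D (D (x * y - y * x)) * a =
        D (D y) * (x * a - a * x) + (D y * (D x * a - a * D x) + D y * (D x * a - a * D x))
        + y * (D (D x) * a - a * D (D x))"
      by (simp add: D_mult D_add D_diff Da algebra_simps)
    also have "\<dots> = - (D y * D (D x) + D y * D (D x) + D (D y) * D x)"
      by (simp add: xa D3 algebra_simps)
    finally have "- (D y * D (D x) + D y * D (D x) + D (D y) * D x) = 0"
      by (simp only: e0 mult_zero_left diff_0_right)
    then show ?thesis by (simp only: neg_equal_0_iff_equal)
  qed
  have e2: "D (D y) * D (D x) = 0" for x y
    using e1[of "D y" x] torsion_free[of "D (D y) * D (D x)"] by (simp add: D3)
  have e4: "D (D y) * (D x * D t) + D (D y) * (D x * D t) + D (D y) * (x * D (D t)) = 0" for x y t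
  proof -
    have "D (D y) * D (D (x * t)) = D (D y) * D (D x) * t +
        (D (D y) * (D x * D t) + D (D y) * (D x * D t) + D (D y) * (x * D (D t)))"
      by (simp add: D_mult D_add distrib_left mult.assoc add.assoc)
    then show ?thesis by (simp add: e2)
  qed
  have Q: "D (D y) * x * (D (D s) * D t) = 0" for x y s t
  proof -
    define p where "p = D (D y) * (D x * (D s * D t))"
    define q where "q = D (D y) * (x * (D (D s) * D t))"
    define w where "w = D (D y) * (x * (D s * D (D t)))"
    have 1: "p + p + q = 0"
      using arg_cong[OF e4[of y x s], of "\<lambda>u. u * D t"]
      by (simp add: p_def q_def algebra_simps)
    have 2: "w + w + q = 0"
      using arg_cong[OF e1[of s t], of "\<lambda>u. D (D y) * (x * u)"]
      by (simp add: w_def q_def algebra_simps)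
    have 3: "(p + q) + (p + q) + w = 0"
      using e4[of y "x * D s" t] by (simp add: p_def q_def w_def D_mult algebra_simps)
    \<comment> \<open>This combination of the three relations eliminates p and w and leaves q with
      coefficient 1.\<close>
    have "q = ((p + q) + (p + q) + w) + ((p + q) + (p + q) + w) - (p + p + q) - (p + p + q)
        - (w + w + q)"
      by (simp add: algebra_simps)
    then have "q = 0" by (simp only: 1 2 3) simp
    then show ?thesis by (simp add: q_def mult.assoc)
  qed
  have D2: "D (D y) = 0" for y
  proof (rule ccontr)
    assume y: "D (D y) \<noteq> 0"
    have *: "D (D s) * D t = 0" for s t
      using prime_rng[of "D (D y)" "D (D s) * D t"] Q y by blast
    \<comment> \<open>Expanding D(tr) in \<open>*\<close> puts an arbitrary t between D^2 y and
      Dr.\<close>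
    have "D (D y) * t * D r = 0" for t r
      using *[of y "t * r"] *[of y t] by (simp add: D_mult distrib_left flip: mult.assoc)
    then have "D r = 0" for r
      using prime_rng[of "D (D y)" "D r"] y by blast
    then show False using y by simp
  qed
  \<comment> \<open>With D^2 = 0 on all elements, D^2(xy) reduces to 2 Dx Dy.\<close>
  have DD: "D x * D y = 0" for x y
    using D2[of "x * y"] torsion_free[of "D x * D y"] by (simp add: D_mult D_add D2)
  have "D x * r * D y = 0" for x y r
    using DD[of x "r * y"] DD[of x r] by (simp add: D_mult distrib_left flip: mult.assoc)
  then have "D x = 0" for x
    using prime_rng[of "D x" "D x"] by blast
  then show ?thesis
    by (simp add: central_iff_commutator D_def)
qed

section \<open>Prime rings of characteristic 2\<close>

text \<open>After inverting \<open>z\<close>, the ring is spanned by \<open>1, e1, e2, e3\<close> over its center.\<close>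

definition central_rank_le_4 :: "'a::ring itself \<Rightarrow> bool" where
  "central_rank_le_4 _ \<longleftrightarrow> (\<exists>z e1 e2 e3 :: 'a. central z \<and> z \<noteq> 0 \<and>
     (\<forall>x. \<exists>c0 c1 c2 c3. central c0 \<and> central c1 \<and> central c2 \<and> central c3 \<and>
        z * x = c0 + c1 * e1 + c2 * e2 + c3 * e3))"

text \<open>In characteristic 2 this is \<open>s\<^sub>4\<close>, with its 24 terms grouped by the 3 ways to pair the arguments.\<close>

definition s4_char_2 :: "'a::ring \<Rightarrow> 'a \<Rightarrow> 'a \<Rightarrow> 'a \<Rightarrow> 'a" where
  "s4_char_2 w x y z =
     commutator w x * commutator y z + commutator y z * commutator w x +
     (commutator w y * commutator x z + commutator x z * commutator w y) +
     (commutator w z * commutator x y + commutator x y * commutator w z)"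

section \<open>Characteristic 2: signs, the identity \<open>s4_char_2\<close> and central
  squares\<close>

locale prime_rng_char_2 =
  fixes ty :: "'a::prime_rng itself"
  assumes add_self [simp]: "(x::'a) + x = 0"
begin

lemma add_self_left [simp]: "(x::'a) + (x + y) = y"
  by (metis add_self add.assoc add.left_neutral)

lemma minus_eq [simp]: "- (x::'a) = x"
  by (metis add_self minus_unique)

lemma diff_eq [simp]: "(x::'a) - y = x + y"
  by (metis diff_conv_add_uminus minus_eq)

lemma commutator_eq: "commutator (x::'a) y = x * y + y * x"
  by (simp add: commutator_def)

lemma commutator_sym: "commutator (x::'a) y = commutator y x"
  by (simp add: commutator_def add.commute)

lemma add_eq_0: "(x::'a) + y = 0 \<longleftrightarrow> x = y"
  by (metis add_self add_self_left add.right_neutral)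

lemma eq_0_if_annihilates: "(\<And>y. (x::'a) * y = 0) \<Longrightarrow> x = 0"
  using prime_rng[of x x] by simp

text \<open>Each argument in turn is expanded over the spanning elements. The center contributes 0,
  so only arguments from \<open>{e1, e2, e3}\<close> remain, and among four of them one is
  repeated.\<close>

lemma s4_char_2_eq_0:
  assumes "central_rank_le_4 (TYPE('a))"
  shows "s4_char_2 x1 x2 x3 x4 = (0::'a)"
proof -
  obtain z e1 e2 e3 :: 'a where z: "central z" "z \<noteq> 0" and
    span: "\<And>x. \<exists>c0 c1 c2 c3. central c0 \<and> central c1 \<and> central c2 \<and> central c3 \<and>
        z * x = c0 + c1 * e1 + c2 * e2 + c3 * e3"
    using assms unfolding central_rank_le_4_def by blast
  \<comment> \<open>An additive map that is linear over the center and kills the center and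
    \<open>e1\<close>, \<open>e2\<close>, \<open>e3\<close> also kills \<open>z * x\<close>, and
    \<open>z\<close> can be cancelled.\<close>
  have vanish: "g x = 0"
    if add: "\<And>x y. g (x + y) = g x + g y" and smult: "\<And>c x. central c \<Longrightarrow> g (c * x) = c * g x"
      and cent: "\<And>c. central c \<Longrightarrow> g c = 0" and e: "\<And>e. e \<in> {e1, e2, e3} \<Longrightarrow> g e = 0"
    for g :: "'a \<Rightarrow> 'a" and x
  proof -
    obtain c0 c1 c2 c3 where c: "central c0" "central c1" "central c2" "central c3"
      "z * x = c0 + c1 * e1 + c2 * e2 + c3 * e3"
      using span by blast
    have "z * g x = g (c0 + c1 * e1 + c2 * e2 + c3 * e3)"
      using smult[OF z(1)] c(5) by metis
    also have "\<dots> = 0"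
      using c(1-4) e by (simp add: add smult cent)
    finally show ?thesis using central_mult_eq_0[OF z(1)] z(2) by blast
  qed
  have comm: "commutator (c * x) y = c * commutator x y" "commutator y (c * x) = c * commutator y x"
    if "central c" for c x y :: 'a
    using that by (simp_all add: commutator_mult_left commutator_mult_right
        commutator_central_left commutator_central_right)
  have left: "x * (c * y) = c * (x * y)" if "central c" for c x y :: 'a
    by (metis that centralD mult.assoc)
  note lin = s4_char_2_def comm commutator_add_left commutator_add_right commutator_central_left
    commutator_central_right left algebra_simps
  have 0: "s4_char_2 e e' e'' e''' = 0"
    if "e \<in> {e1, e2, e3}" "e' \<in> {e1, e2, e3}" "e'' \<in> {e1, e2, e3}" "e''' \<in> {e1, e2, e3}"
    for e e' e'' e'''
  proof -
    have "s4_char_2 x x y w = 0" "s4_char_2 x y x w = 0" "s4_char_2 x y w x = 0"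
      "s4_char_2 y x x w = 0" "s4_char_2 y x w x = 0" "s4_char_2 y w x x = 0" for x y w :: 'a
      by (simp_all add: s4_char_2_def algebra_simps commutator_sym)
    then show ?thesis using that by (elim insertE emptyE) simp_all
  qed
  have 1: "s4_char_2 x1 e e' e'' = 0"
    if "e \<in> {e1, e2, e3}" "e' \<in> {e1, e2, e3}" "e'' \<in> {e1, e2, e3}" for x1 e e' e''
    by (rule vanish[of "\<lambda>x. s4_char_2 x e e' e''"])
      (use that in \<open>blast intro: 0\<close> | simp add: lin)+
  have 2: "s4_char_2 x1 x2 e e' = 0"
    if "e \<in> {e1, e2, e3}" "e' \<in> {e1, e2, e3}" for x1 x2 e e'
    by (rule vanish[of "\<lambda>x. s4_char_2 x1 x e e'"])
      (use that in \<open>blast intro: 1\<close> | simp add: lin)+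
  have 3: "s4_char_2 x1 x2 x3 e = 0" if "e \<in> {e1, e2, e3}" for x1 x2 x3 e
    by (rule vanish[of "\<lambda>x. s4_char_2 x1 x2 x e"])
      (use that in \<open>blast intro: 2\<close> | simp add: lin)+
  show ?thesis
    by (rule vanish[of "\<lambda>x. s4_char_2 x1 x2 x3 x"])
      (blast intro: 3 | simp add: lin)+
qed

text \<open>In characteristic 2, [a,[a,y]] = [a^2,y], so the claim is D^2 = 0 for D = [a,-]. Every
  D^2[x,y] is central, being a commutator of two elements of V; replacing y by ya brings in the
  noncentral factor a.\<close>

lemma central_square_if_commutators_central:
  assumes V: "commutator_submodule V" and a: "a \<in> V"
    and cent: "\<And>a b. a \<in> V \<Longrightarrow> b \<in> V \<Longrightarrow> central (commutator a b)"
  shows "central (a * a :: 'a)"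
proof (cases "central a")
  case True
  then show ?thesis by (simp add: central_mult)
next
  case noncentral: False
  define D where "D = commutator a"
  have D_mult: "D (x * y) = D x * y + x * D y" and D_add: "D (x + y) = D x + D y" for x y
    by (simp_all add: D_def commutator_mult_right commutator_add_right)
  have DD: "central (D (D (commutator x y)))" for x y
    unfolding D_def by (intro cent a commutator_submoduleD(6)[OF V])
  have D_central: "D c = 0" if "central c" for c
    by (simp add: D_def commutator_central_right that)
  have Da: "D a = 0" by (simp add: D_def)
  have D3: "D (D (D x)) = 0" for x
  proof -
    have "central (D (D (D x)))"
      using DD[of a x] by (simp add: D_def)
    \<comment> \<open>Both D^3 x and its multiple by the noncentral a are central, so D^3 x =
      0.\<close>
    moreover have "D (D (commutator a (x * a))) = D (D (D x)) * a"
      by (simp add: commutator_mult_right D_mult Da flip: D_def)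
    ultimately show ?thesis
      using DD[of a "x * a"] central_mult_central noncentral by metis
  qed
  have e: "D (D y) * D (D x) = 0" for x y
  proof -
    \<comment> \<open>The left side is central, hence killed by D, and D of the right side is D^2 y
      D^2 x.\<close>
    have "D (D (commutator x (y * a))) = D (D (commutator x y)) * a + D (D y) * D x"
      by (simp add: commutator_mult_right commutator_sym[of x a] D_mult D_add Da D3 flip: D_def)
    then have "D (D (D (commutator x y)) * a + D (D y) * D x) = 0"
      using D_central[OF DD[of x "y * a"]] by simp
    then show ?thesis by (simp add: D_mult D_add Da D3)
  qed
  have "D (D y) * r * D (D y) = 0" for y r
    using e[of y "r * y"] e[of y r] by (simp add: D_mult D_add distrib_left flip: mult.assoc)
  then have "D (D y) = 0" for y
    using prime_rng[of "D (D y)" "D (D y)"] by blast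
  then show ?thesis
    by (simp add: D_def central_def commutator_eq algebra_simps add_eq_0)
qed

lemma commutator_commutator_self:
  assumes "central (a * a :: 'a)"
  shows "commutator a (commutator a x) = 0"
  using centralD[OF assms, of x] by (simp add: commutator_eq algebra_simps)

text \<open>D = [a,-] and E = [b,-] are commuting derivations of square zero with Db = Ea = z and Da
  = Eb = 0. Up to powers of z, the ring is abC + bC + aC + C, where C is the common kernel of D and
  E, and C turns out to be the center.\<close>

lemma central_rank_le_4_if_nonabelian:
  assumes V: "commutator_submodule V" and a: "a \<in> V" and b: "b \<in> V"
    and nz: "commutator a b \<noteq> (0::'a)"
    and cent: "\<And>a b. a \<in> V \<Longrightarrow> b \<in> V \<Longrightarrow> central (commutator a b)"
  shows "central_rank_le_4 (TYPE('a))"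
proof -
  define D E where "D = commutator a" and "E = commutator b"
  define z where "z = commutator a b"
  have z: "central z" "z \<noteq> 0"
    using cent[OF a b] nz by (simp_all add: z_def)
  have zc: "x * z = z * x" "x * (z * y) = z * (x * y)" if "x \<noteq> z" for x y
    using z(1) by (metis centralD mult.assoc)+
  have D_mult: "D (x * y) = D x * y + x * D y" and D_add: "D (x + y) = D x + D y"
    and E_mult: "E (x * y) = E x * y + x * E y" and E_add: "E (x + y) = E x + E y" for x y
    by (simp_all add: D_def E_def commutator_mult_right commutator_add_right)
  have gen: "D a = 0" "E b = 0" "D b = z" "E a = z" "D z = 0" "E z = 0" "D 0 = 0" "E 0 = 0"
    using commutator_sym[of b a] z(1)
    by (simp_all add: D_def E_def z_def commutator_central_right)
  have "commutator v (commutator v x) = 0" if "v \<in> V" for v x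
    using that by (intro commutator_commutator_self central_square_if_commutators_central[OF V _ cent])
  then have sq: "D (D x) = 0" "E (E x) = 0" for x
    using a b by (simp_all add: D_def E_def)
  have ED: "E (D x) = D (E x)" for x
  proof -
    have "D (E x) = commutator z x + E (D x)"
      by (simp add: D_def E_def z_def commutator_jacobi[of a b x])
    then show ?thesis using z(1) by (simp add: commutator_central_left)
  qed
  have DE: "central (D (E (commutator x y)))" for x y
    unfolding D_def E_def by (intro cent a b commutator_submoduleD(6)[OF V])
  \<comment> \<open>Elements of C commute with a and b by definition and with each other by
    \<open>comm\<close>, hence with everything once the ring is known to be spanned as
    stated.\<close>
  have central_if: "central c" if "D c = 0" "E c = 0"
    and span: "\<And>x. \<exists>c1 c2 c3 c4. D c1 = 0 \<and> E c1 = 0 \<and> D c2 = 0 \<and> E c2 = 0 \<and>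
        D c3 = 0 \<and> E c3 = 0 \<and> D c4 = 0 \<and> E c4 = 0 \<and>
        z * z * z * z * x = a * (b * c1) + b * c2 + a * c3 + c4" for c
  proof -
    have comm: "commutator c y = 0" if "D c = 0" "E c = 0" "D y = 0" "E y = 0" for c y
    proof -
      have cent: "central (commutator c y)" if "D c = 0" "E c = 0" "D y = 0" "E y = 0" for c y
      proof -
        \<comment> \<open>DE strips off the factor ab and returns z^2 [c,y], which is therefore
          central.\<close>
        have "D (E (commutator (a * b * c) y)) = D (E (a * b * (c * y) + y * (a * b * c)))"
          by (simp add: commutator_eq algebra_simps)
        also have "\<dots> = z * (z * (c * y)) + y * (z * (z * c))"
          by (simp add: D_mult D_add E_mult E_add gen that mult.assoc)
        also have "\<dots> = z * (z * commutator c y)"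
          using centralD[OF z(1)] by (simp add: commutator_eq distrib_left) (metis mult.assoc)
        finally show ?thesis
          using DE[of "a * b * c" y] central_mult_central[OF z(1)] z(2) by metis
      qed
      \<comment> \<open>This element is c[c,y]; bracketing it with y gives [c,y]^2 = 0.\<close>
      have "central (commutator c (c * y))"
        by (rule cent) (simp_all add: that D_mult E_mult)
      then have "commutator (commutator c (c * y)) y = 0"
        by (rule commutator_central_left)
      then have "commutator c y * commutator c y = 0"
        using cent[OF that] by (simp add: commutator_mult_right commutator_mult_left commutator_central_left)
      then show ?thesis
        using central_mult_eq_0[OF cent[OF that]] by blast
    qed
    have "commutator c a = 0" "commutator c b = 0"
      using that commutator_sym by (simp_all add: D_def E_def)
    have "commutator c (z * z * z * z * x) = 0" for x
    proof -
      obtain c1 c2 c3 c4 where "D c1 = 0" "E c1 = 0" "D c2 = 0" "E c2 = 0"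
        "D c3 = 0" "E c3 = 0" "D c4 = 0" "E c4 = 0"
        and x: "z * z * z * z * x = a * (b * c1) + b * c2 + a * c3 + c4"
        using span by blast
      with comm[OF that(1,2)] \<open>commutator c a = 0\<close> \<open>commutator c b = 0\<close> show ?thesis
        unfolding x by (simp add: commutator_mult_right commutator_add_right)
    qed
    then have "z * z * z * z * commutator c x = 0" for x
      using z(1) by (simp add: commutator_mult_right commutator_central_right)
    then have "commutator c x = 0" for x
      using central_mult_eq_0[OF z(1)] z(2) by (metis mult.assoc)
    then show ?thesis by (simp add: central_iff_commutator)
  qed
  have span: "\<exists>c1 c2 c3 c4. D c1 = 0 \<and> E c1 = 0 \<and> D c2 = 0 \<and> E c2 = 0 \<and>
        D c3 = 0 \<and> E c3 = 0 \<and> D c4 = 0 \<and> E c4 = 0 \<and>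
        z * z * z * z * x = a * (b * c1) + b * c2 + a * c3 + c4" for x
  proof -
    \<comment> \<open>For c in C, DE(abc) = z^2 c, D(bc) = zc and E(ac) = zc. Each coefficient is
      read off by the matching derivation and its term removed; the factors z^2, z and z replace
      division.\<close>
    define c1 where "c1 = D (E x)"
    define x1 where "x1 = z * z * x + a * (b * c1)"
    define c2 where "c2 = D x1"
    define x2 where "x2 = z * x1 + b * c2"
    define c3 where "c3 = E x2"
    define c4 where "c4 = z * x2 + a * c3"
    have c1: "D c1 = 0" "E c1 = 0" by (simp_all add: c1_def sq ED gen)
    have "D (E x1) = 0"
      by (simp add: x1_def D_mult D_add E_mult E_add gen c1 mult.assoc) (simp add: c1_def gen)
    then have c2: "D c2 = 0" "E c2 = 0" by (simp_all add: c2_def sq ED gen)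
    have "D x2 = 0"
      by (simp add: x2_def D_mult D_add gen c2) (simp add: c2_def gen)
    then have c3: "D c3 = 0" "E c3 = 0" using ED[of x2] by (simp_all add: c3_def sq gen)
    have "D c4 = 0" using \<open>D x2 = 0\<close> by (simp add: c4_def D_mult D_add gen c3)
    moreover have "E c4 = 0"
      by (simp add: c4_def E_mult E_add gen c3) (simp add: c3_def gen)
    moreover have "z * z * z * z * x =
        a * (b * (z * z * c1)) + b * (z * c2) + a * c3 + c4"
    proof -
      have eqs: "z * x2 = c4 + a * c3" "z * x1 = x2 + b * c2" "z * z * x = x1 + a * (b * c1)"
        by (simp_all add: c4_def x2_def x1_def ac_simps)
      have "z * z * z * z * x = z * z * (z * z * x)" by (simp add: mult.assoc)
      also have "\<dots> = z * (z * x1) + z * z * (a * (b * c1))"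
        unfolding eqs(3) by (simp add: algebra_simps)
      also have "\<dots> = z * x2 + z * (b * c2) + z * z * (a * (b * c1))"
        unfolding eqs(2) by (simp add: algebra_simps)
      finally have *: "z * z * z * z * x = z * z * (a * (b * c1)) + z * (b * c2) + a * c3 + c4"
        unfolding eqs(1) by (simp add: algebra_simps)
      have "z * z * (a * (b * c1)) = a * (b * (z * z * c1))" "z * (b * c2) = b * (z * c2)"
        using centralD[OF z(1)] by (metis mult.assoc)+
      then show ?thesis using * by (simp only:)
    qed
    moreover have "D (z * z * c1) = 0" "E (z * z * c1) = 0" "D (z * c2) = 0" "E (z * c2) = 0"
      by (simp_all add: D_mult E_mult gen c1 c2)
    ultimately show ?thesis using c3 by blast
  qed
  show ?thesis
    unfolding central_rank_le_4_def
  proof (rule exI[of _ "z * z * z * z"], rule exI[of _ a], rule exI[of _ b], rule exI[of _ "a * b"],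
      intro conjI allI)
    show "central (z * z * z * z)" using z(1) by (intro central_mult)
    show "z * z * z * z \<noteq> 0" using central_mult_eq_0[OF z(1)] z(2) by (metis mult.assoc)
  next
    fix x
    obtain c1 c2 c3 c4 where "D c1 = 0" "E c1 = 0" "D c2 = 0" "E c2 = 0"
        "D c3 = 0" "E c3 = 0" "D c4 = 0" "E c4 = 0"
        "z * z * z * z * x = a * (b * c1) + b * c2 + a * c3 + c4"
      using span by blast
    moreover from this have "central c1" "central c2" "central c3" "central c4"
      using central_if[OF _ _ span] by blast+
    moreover have "a * (b * c1) + b * c2 + a * c3 + c4 = c4 + c3 * a + c2 * b + c1 * (a * b)"
    proof -
      have "a * (b * c1) = c1 * (a * b)" using centralD[OF \<open>central c1\<close>] by (metis mult.assoc)
      moreover have "b * c2 = c2 * b" "a * c3 = c3 * a"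
        using centralD[OF \<open>central c2\<close>] centralD[OF \<open>central c3\<close>] by simp_all
      ultimately show ?thesis by (simp add: ac_simps)
    qed
    ultimately show "\<exists>c0 c1 c2 c3. central c0 \<and> central c1 \<and> central c2 \<and> central c3 \<and>
        z * z * z * z * x = c0 + c1 * a + c2 * b + c3 * (a * b)"
      by metis
  qed
qed

end

section \<open>Abelian submodules in characteristic 2\<close>

locale abelian_submodule_char_2 = prime_rng_char_2 ty
  for ty :: "'a::prime_rng itself" +
  fixes V :: "'a set"
  assumes submodule: "commutator_submodule V"
    and abelian: "\<And>a b. a \<in> V \<Longrightarrow> b \<in> V \<Longrightarrow> commutator a b = 0"
begin

lemma central_square: "a \<in> V \<Longrightarrow> central (a * a)"
  by (rule central_square_if_commutators_central[OF submodule]) (simp_all add: abelian)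

lemma commutator_twice: "a \<in> V \<Longrightarrow> commutator a (commutator a x) = 0"
  by (intro commutator_commutator_self central_square)

text \<open>Let D = [a,-] and E = [b,-]. As [b,[x,y]] lies in the abelian V, DE kills all
  commutators. If DE were nonzero, products of three values of D would vanish, then products of two,
  and finally D itself.\<close>

lemma commutator_commutator:
  assumes a: "a \<in> V" and b: "b \<in> V"
  shows "commutator a (commutator b x) = 0"
proof (rule ccontr)
  assume nz: "commutator a (commutator b x) \<noteq> 0"
  define D E where "D = commutator a" and "E = commutator b"
  have D_mult: "D (x * y) = D x * y + x * D y" and D_add: "D (x + y) = D x + D y"
    and E_mult: "E (x * y) = E x * y + x * E y" and E_add: "E (x + y) = E x + E y" for x y
    by (simp_all add: D_def E_def commutator_mult_right commutator_add_right)
  have zero: "D 0 = 0" "E 0 = 0" "D a = 0" "E a = 0"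
    using abelian[OF b a] by (simp_all add: D_def E_def)
  have sq: "D (D x) = 0" "E (E x) = 0" for x
    using a b by (simp_all add: D_def E_def commutator_twice)
  have ED: "E (D x) = D (E x)" for x
    using abelian[OF b a] by (simp add: D_def E_def commutator_jacobi[of b a x])
  have DE: "D (E (x * y + y * x)) = 0" for x y
    unfolding D_def E_def using abelian[OF a commutator_submoduleD(6)[OF submodule b, of x y]]
    by (simp add: commutator_eq[of x y])
  have xa: "x * a = a * x + D x" for x
    by (simp add: D_def commutator_eq)
  have e1: "D y * D (E x) = D (E y) * D x" for x y
  proof -
    \<comment> \<open>Both terms on the left vanish, and what remains on the right are commutators
      with a, each of which is one more D.\<close>
    have "D (E (x * (y * a) + (y * a) * x)) + D (E (x * y + y * x)) * a =
      y * (D (E x) * a + a * D (E x)) + D (E y) * (x * a + a * x) + D y * (E x * a + a * E x) +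
      E y * (D x * a + a * D x)"
      by (simp add: D_mult D_add E_mult E_add zero ED algebra_simps)
    also have "\<dots> = D (E y) * D x + D y * D (E x)"
      by (simp add: xa sq ED zero add.commute add.left_commute)
    finally show ?thesis by (simp add: DE add_eq_0)
  qed
  have e2: "D (E s) * D v * D x = 0" for s v x
  proof -
    \<comment> \<open>Expanding this instance of \<open>e1\<close> produces two terms that cancel by
      \<open>e1\<close> itself.\<close>
    have "D (s * D v) * D (E x) = D (E (s * D v)) * D x" by (rule e1)
    then have "D s * (D v * D (E x)) = D (E s) * D v * D x + D s * (D (E v) * D x)"
      by (simp add: D_mult D_add E_mult E_add sq ED zero algebra_simps)
    then show ?thesis
      unfolding e1 by (metis add_self add.commute add_self_left add_left_cancel)
  qed
  have e3: "D s * D v * D (E x) = 0" for s v x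
    using e2[of s v x] by (simp add: mult.assoc e1) (simp add: e1 flip: mult.assoc)
  have e4: "D s * D v * r * D (E x) = D s * v * D r * D (E x)" for s v r x
    using e3[of s "v * r" x] by (simp add: D_mult algebra_simps add_eq_0)
  have "D q * D s * D v * r * D (E x) = 0" for q s v r x
  proof -
    \<comment> \<open>\<open>e4\<close> moves D first from v to r and then from s to v; the result
      ends in Dv Dr DEx, which \<open>e3\<close> kills.\<close>
    have "D q * D s * (D v * r) * D (E x) = D q * (D s * v * D r * D (E x))"
      using e4[of s v r x] by (simp add: mult.assoc)
    also have "\<dots> = D q * D s * (v * D r) * D (E x)"
      by (simp add: mult.assoc)
    also have "\<dots> = D q * s * (D v * D r * D (E x))"
      unfolding e4 by (simp add: D_mult sq mult.assoc)
    finally have "D q * D s * (D v * r) * D (E x) = 0" by (simp only: e3 mult_zero_right)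
    then show ?thesis by (simp add: mult.assoc)
  qed
  then have e5: "D q * D s * D v = 0" for q s v
    using prime_rng[of "D q * D s * D v" "D (E x)"] nz by (auto simp: D_def E_def)
  have "D p * D q * s * (D t * D v) = 0" for p q s t v
    using e5[of q "s * t" v] e5[of p q s] e5[of p q "s * t"]
    by (simp add: D_mult distrib_left distrib_right flip: mult.assoc)
  then have e6: "D p * D q = 0" for p q
    using prime_rng[of "D p * D q" "D p * D q"] by blast
  have "D p * s * D q = 0" for p s q
    using e6[of p "s * q"] e6[of p s] by (simp add: D_mult distrib_left flip: mult.assoc)
  then have "D p = 0" for p
    using prime_rng[of "D p" "D p"] by blast
  then show False
    using nz by (simp add: D_def)
qed

text \<open>For D = [a,-], [x,xa] = x Dx, and applying D gives (Dx)^2 because D^2 = 0.\<close>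

lemma square_commutator_mem:
  assumes "a \<in> V"
  shows "commutator a x * commutator a x \<in> V"
proof -
  have "commutator a x * commutator a x = commutator a (commutator x (x * a))"
    using commutator_twice[OF assms, of x] by (simp add: commutator_mult_right commutator_sym[of x a])
  then show ?thesis
    using commutator_submoduleD(6)[OF submodule assms] by simp
qed

lemma commutator_image_mem:
  assumes "a \<in> V"
  shows "commutator (commutator a x) (commutator a y) \<in> V"
proof -
  have "commutator (commutator a x) (commutator a y) = commutator a (commutator x (commutator a y))"
    by (simp add: commutator_jacobi[of a x] commutator_twice assms)
  then show ?thesis
    using commutator_submoduleD(6)[OF submodule assms] by simp
qed

lemma commutator_image_nilpotent:
  assumes "a \<in> V"
  shows "commutator (commutator (commutator a x) (commutator a y)) (commutator a s) = 0"
  by (intro commutator_commutator commutator_image_mem assms)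

text \<open>For D = [a,-], [Dx, D(y Dx)] = [Dx,Dy] Dx. Bracketing this with Ds gives 0 by
  nilpotency, and the only surviving term is [Dx,Dy][Dx,Ds].\<close>

lemma commutator_image_square_zero:
  assumes a: "a \<in> V"
  shows "commutator (commutator a x) (commutator a y) * commutator (commutator a x) (commutator a s) = 0"
proof -
  have "commutator (commutator (commutator a x) (commutator a (y * commutator a x))) (commutator a s) = 0"
    by (rule commutator_image_nilpotent[OF a])
  then show ?thesis
    by (simp add: commutator_mult_right commutator_mult_left commutator_twice[OF a]
        commutator_image_nilpotent[OF a])
qed

lemma commutator_image_abelian_if_reduced:
  assumes "a \<in> V" and "\<And>v. v \<in> V \<Longrightarrow> v * v = 0 \<Longrightarrow> v = 0"
  shows "commutator (commutator a x) (commutator a y) = 0"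
  by (rule assms(2)) (intro commutator_image_mem commutator_image_square_zero assms(1))+

section \<open>Square-zero elements of the submodule and their corners\<close>

context
  fixes k
  assumes k: "k \<in> V" "k * k = 0"
begin

text \<open>The additive group \<open>kRk\<close> is a prime ring with the product \<open>kxk \<cdot> kyk = kxkyk\<close>.\<close>

lemma corner_commute: "k * x * k * y * k = k * y * k * x * k"
proof -
  have kk: "k * k = 0" "k * (k * z) = 0" for z
    using k(2) by (metis mult.assoc mult_zero_left)+
  \<comment> \<open>This measures the failure of commutativity in the corner kRk.\<close>
  define c where "c x y = k * (x * (k * (y * k))) + k * (y * (k * (x * k)))" for x y
  have comm: "c x y * (s * k) = k * (s * c x y)" for x y s
  proof -
    have "k * commutator (commutator (commutator k x) (commutator k y)) (commutator k s) =
        c x y * (s * k) + k * (s * c x y)"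
      by (simp add: c_def commutator_eq algebra_simps kk)
    then show ?thesis by (simp add: commutator_image_nilpotent k(1) add_eq_0)
  qed
  have comm': "c x y * (s * (k * z)) = k * (s * (c x y * z))" for x y s z
    using arg_cong[OF comm[of x y s], of "\<lambda>u. u * z"] by (simp only: mult.assoc)
  have beta: "c x y * (x * (k * (s * k)) + s * (k * (x * k))) = 0" for x y s
  proof -
    \<comment> \<open>Thus \<open>comm\<close> applies both to c(x,y) and to its multiple by xk, and
      comparing the two gives \<open>beta\<close>.\<close>
    have "c x (y * (k * x)) = c x y * (x * k)"
      by (simp add: c_def algebra_simps)
    then have "c x y * (x * (k * (s * k))) = k * (s * (c x y * (x * k)))"
      using comm[of x "y * (k * x)" s] by (simp add: mult.assoc)
    moreover have "c x y * (s * (k * (x * k))) = k * (s * (c x y * (x * k)))"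
      by (rule comm')
    ultimately show ?thesis
      by (simp only: distrib_left add_self)
  qed
  have "c x y * r * c x s = 0" for r s
  proof -
    \<comment> \<open>By \<open>comm'\<close>, c(x,y) moves past r and k, where it meets the factor
      that \<open>beta\<close> annihilates.\<close>
    have "c x y * r * c x s = k * (r * (c x y * (x * (k * (s * k)) + s * (k * (x * k)))))"
      unfolding c_def[of x s] by (simp only: mult.assoc distrib_left comm'[of x y r])
    then show ?thesis by (simp add: beta)
  qed
  then have "c x y = 0"
    using prime_rng[of "c x y" "c x y"] by blast
  then show ?thesis by (simp add: c_def add_eq_0 mult.assoc)
qed

text \<open>By commutativity of the corner, a vanishing product kxkyk still vanishes with any r
  inserted between kxk and kyk.\<close>

lemma corner_domain:
  assumes "k * x * k * y * k = 0"
  shows "k * x * k = 0 \<or> k * y * k = 0"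
proof (rule prime_rng)
  fix r
  have "k * x * k * r * (k * y * k) = (k * x * k * r * k) * y * k"
    by (simp add: mult.assoc)
  also have "\<dots> = k * r * (k * x * k * y * k)"
    unfolding corner_commute[of x r] by (simp add: mult.assoc)
  finally show "k * x * k * r * (k * y * k) = 0" by (simp add: assms)
qed

text \<open>If kxk \<noteq> 0, then N = [[k,x],[k,y]] satisfies N R kxk = 0. If kxk = 0, then x is a
  difference of two elements for which this product is nonzero.\<close>

lemma commutator_image_abelian:
  "commutator (commutator k x) (commutator k y) = 0"
proof (cases "k = 0")
  case nz: False
  have kk: "k * k = 0" "k * (k * z) = 0" for z
    using k(2) by (metis mult.assoc mult_zero_left)+
  have A1: "k * (x * (k * (y * k))) = k * (y * (k * (x * k)))" for x y
    using corner_commute[of x y] by (simp add: mult.assoc)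
  have A1': "k * (x * (k * (y * (k * z)))) = k * (y * (k * (x * (k * z))))" for x y z
    using arg_cong[OF A1[of x y], of "\<lambda>u. u * z"] by (simp add: mult.assoc)
  have A2: "k * (x * (k * (y * (z * k)))) = k * (y * (z * (k * (x * k))))" for x y z
    using corner_commute[of x "y * z"] by (simp add: mult.assoc)
  have A2': "k * (x * (k * (y * (z * (k * w))))) = k * (y * (z * (k * (x * (k * w)))))" for x y z w
    using arg_cong[OF A2[of x y z], of "\<lambda>u. u * w"] by (simp add: mult.assoc)
  have *: "commutator (commutator k x) (commutator k y) = 0" if h: "k * x * k \<noteq> 0" for x y
  proof -
    define u N where "u = commutator k x" and "N = commutator (commutator k x) (commutator k y)"
    \<comment> \<open>N commutes with u by nilpotency, and the last two summands do so by
      commutativity of the corner; hence so does the first.\<close>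
    have "N = commutator (k * x * k) y + commutator (k * y * k) x + k * commutator x y * k"
      by (simp add: N_def commutator_eq algebra_simps kk)
    moreover have "commutator N u = 0"
      unfolding N_def u_def by (rule commutator_image_nilpotent[OF k(1)])
    moreover have "commutator (commutator (k * y * k) x) u = 0"
      "commutator (k * commutator x y * k) u = 0"
      unfolding u_def by (simp_all add: commutator_eq algebra_simps kk A1 A1' A2 A2')
    ultimately have "commutator (commutator (k * x * k) y) u = 0"
      by (simp add: commutator_add_left)
    moreover have "N * s * (k * x * k) = commutator (commutator (k * x * k) y) u * s * k" for s
      by (simp add: N_def u_def commutator_eq algebra_simps kk A1 A1' A2 A2')
    ultimately have "N * s * (k * x * k) = 0" for s by simp
    then show ?thesis
      using prime_rng[of N "k * x * k"] h by (auto simp: N_def)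
  qed
  obtain x0 where x0: "k * x0 * k \<noteq> 0"
    using prime_rng[of k k] nz by blast
  show ?thesis
  proof (cases "k * x * k = 0")
    case True
    then have "k * (x0 + x) * k \<noteq> 0" using x0 by (simp add: distrib_left distrib_right)
    from *[OF this, of y] *[OF x0, of y] show ?thesis
      by (simp add: commutator_add_right commutator_add_left)
  qed (rule *)
qed simp

end

end

section \<open>Square-zero inner derivations with commutative image\<close>

locale commuting_derivation_char_2 = prime_rng_char_2 ty
  for ty :: "'a::prime_rng itself" +
  fixes a :: 'a
  assumes noncentral: "\<not> central a"
    and square_central: "central (a * a)"
    and commuting: "commutator (commutator a x) (commutator a y) = 0"
begin

abbreviation "D \<equiv> commutator a"

lemma D_D: "D (D x) = 0"
  by (rule commutator_commutator_self[OF square_central])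

lemmas D_add = commutator_add_right[of a]
lemmas D_mult = commutator_mult_right[of a]

lemma D_commute: "D x * D y = D y * D x"
  using commuting[of x y] by (simp add: commutator_eq_0_iff)

lemma D_nonzero: "(\<And>x. D x = 0) \<Longrightarrow> P"
  using noncentral by (simp add: central_iff_commutator)

text \<open>Since D(R) is commutative, [Dx,D(yt)] = 0 expands to Dy [Dx,t] + [Dx,y] Dt = 0;
  replacing y by wy frees the middle factor.\<close>

lemma D_exchange: "D w * y * commutator (D x) t = commutator (D x) w * y * D t"
proof -
  have *: "D y * commutator (D x) t + commutator (D x) y * D t = 0" for y
    using commuting[of x "y * t"] by (simp add: D_mult commutator_add_right commuting
        commutator_mult_right[of "D x"])
  have "D w * y * commutator (D x) t + commutator (D x) w * y * D t =
      D (w * y) * commutator (D x) t + commutator (D x) (w * y) * D t +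
      w * (D y * commutator (D x) t + commutator (D x) y * D t)"
    by (simp add: D_mult commutator_mult_right[of "D x"] distrib_left distrib_right mult.assoc ac_simps)
  also have "\<dots> = 0" unfolding * by simp
  finally show ?thesis by (simp add: add_eq_0)
qed

lemma annihilates_D_image: "(\<And>x. D x * s = 0) \<Longrightarrow> s = 0"
proof -
  assume s: "\<And>x. D x * s = 0"
  have "D x * y * s = 0" for x y
    using s[of "x * y"] s[of y] by (simp add: D_mult distrib_right mult.assoc)
  then show "s = 0"
    using prime_rng[of "D _" s] D_nonzero by metis
qed

text \<open>If all (Dx)^2 vanished, a nonzero product u = Dx Dw would be central with square 0,
  which primeness forbids. So D(R) D(R) = 0, and then D = 0.\<close>

lemma exists_square_nonzero: "\<exists>x. D x * D x \<noteq> 0"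
proof (rule ccontr)
  assume "\<nexists>x. D x * D x \<noteq> 0"
  then have sq: "D x * D x = 0" for x by blast
  have sq': "D x * (D x * y) = 0" for x y using sq[of x] by (metis mult.assoc mult_zero_left)
  have right: "commutator (D x) t * D t = 0" for x t
  proof -
    have "D w * y * (commutator (D x) t * D t) = 0" for w y
      using arg_cong[OF D_exchange[of w y x t], of "\<lambda>u. u * D t"] by (simp add: mult.assoc sq)
    then show ?thesis
      using prime_rng[of "D _" "commutator (D x) t * D t"] D_nonzero by metis
  qed
  have "D x * D w = 0" for x w
  proof (rule ccontr)
    assume nz: "D x * D w \<noteq> 0"
    define u where "u = D (x * D w)"
    have u: "u = D x * D w" by (simp add: u_def D_mult D_D)
    have comm_u: "commutator u w = D x * commutator (D w) w"
      using right[of x w] by (simp add: u commutator_mult_left)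
    have "u * y * commutator u w = 0" for y
    proof -
      have "u * y * commutator u w = D x * (D w * y * commutator u w)"
        by (simp add: u mult.assoc)
      \<comment> \<open>The exchange brings [u,w] = Dx [Dw,w] next to Dx, where (Dx)^2 = 0
        applies.\<close>
      also have "\<dots> = D x * (commutator u w * y * D w)"
        unfolding u_def by (simp only: D_exchange)
      also have "\<dots> = 0" by (simp add: comm_u mult.assoc sq')
      finally show ?thesis .
    qed
    then have "commutator u w = 0"
      using prime_rng[of u "commutator u w"] nz u by auto
    then have "commutator u s * y * D w = 0" for s y
      using D_exchange[of s y "x * D w" w] by (simp add: u_def)
    then have "central u"
      using prime_rng[of "commutator u _" "D w"] nz unfolding central_iff_commutator
      by (metis mult_zero_right)
    moreover have "u * u = 0" by (simp add: u_def sq)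
    ultimately show False
      using central_mult_eq_0[of u u] nz u by auto
  qed
  then show False
    using annihilates_D_image[of "D _"] D_nonzero by metis
qed

text \<open>For t in the kernel, Dx t = D(xt) commutes with D(R), hence so does t; applying this to
  D(xs) = Dx s shows that t commutes with s. The left factors Dx are cancelled by
  \<open>annihilates_D_image\<close>.\<close>

lemma kernel_commute:
  assumes "D s = 0" "D t = 0"
  shows "s * t = t * s"
proof -
  have *: "t * D y = D y * t" if t: "D t = 0" for t y
  proof -
    have "D x * commutator t (D y) = 0" for x
    proof -
      have "D x * (t * D y) = D (x * t) * D y" by (simp add: D_mult t mult.assoc)
      also have "\<dots> = D y * D (x * t)" by (rule D_commute)
      also have "\<dots> = D y * D x * t" by (simp add: D_mult t mult.assoc)
      also have "\<dots> = D x * (D y * t)" unfolding D_commute[of y x] by (rule mult.assoc)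
      finally show ?thesis by (simp add: commutator_eq distrib_left)
    qed
    then show ?thesis
      using annihilates_D_image commutator_eq_0_iff by blast
  qed
  have "D x * commutator s t = 0" for x
  proof -
    have "D x * s * t = t * (D x * s)"
      using *[OF assms(2), of "x * s"] by (simp add: D_mult assms)
    also have "\<dots> = D x * t * s"
      using *[OF assms(2), of x] by (simp flip: mult.assoc)
    finally show ?thesis by (simp add: commutator_eq[of s t] distrib_left flip: mult.assoc)
  qed
  then show ?thesis
    using annihilates_D_image commutator_eq_0_iff by blast
qed

text \<open>Let Z be the center and u = Dx0. After inverting z = u^4, the kernel of D is Z + Za, and
  every x is x0 (Dx)/u plus an element of the kernel. So 1, a, x0 and x0 a span.\<close>

lemma central_rank_le_4:
  assumes zeta: "central (D x0 * D x0 * D x0 * D x0)" and nz: "D x0 * D x0 * D x0 * D x0 \<noteq> 0"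
  shows "central_rank_le_4 (TYPE('a))"
proof -
  define u where "u = D x0"
  define u3 where "u3 = u * u * u"
  define z where "z = u * u * u * u"
  have z: "central z" "z \<noteq> 0" using zeta nz by (simp_all add: z_def u_def)
  have zu: "u3 * u = z" "u * u3 = z" by (simp_all add: z_def u3_def mult.assoc)
  have Du: "D u = 0" "D u3 = 0" by (simp_all add: u_def u3_def D_mult D_D)
  \<comment> \<open>This describes Za + Z, which is a subring because a^2 is central.\<close>
  define lin where "lin x \<longleftrightarrow> (\<exists>c d. central c \<and> central d \<and> x = c * a + d)" for x
  have lin_add: "lin (x + y)" if "lin x" "lin y" for x y
  proof -
    from that obtain c d c' d' where "central c" "central d" "x = c * a + d"
      "central c'" "central d'" "y = c' * a + d'"
      unfolding lin_def by blast
    then show ?thesis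
      unfolding lin_def by (intro exI[of _ "c + c'"] exI[of _ "d + d'"])
        (simp add: central_add algebra_simps)
  qed
  have lin_mult: "lin (x * y)" if "lin x" "lin y" for x y
  proof -
    from that obtain c d c' d' where c: "central c" "central d" "x = c * a + d"
      "central c'" "central d'" "y = c' * a + d'"
      unfolding lin_def by blast
    have "c * a * (c' * a) = c * c' * (a * a)" "c * a * d' = c * d' * a"
      using centralD[OF c(4), of a] centralD[OF c(5), of a] by (metis mult.assoc)+
    then have "x * y = (c * d' + d * c') * a + (c * c' * (a * a) + d * d')"
      by (simp add: c(3,6) algebra_simps)
    then show ?thesis
      unfolding lin_def using c square_central
      by (intro exI[of _ "c * d' + d * c'"] exI[of _ "c * c' * (a * a) + d * d'"])
        (simp add: central_add central_mult)
  qed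
  have lin_D: "lin (z * D x)" for x
  proof -
    define p where "p = commutator (D x) x0"
    \<comment> \<open>Here c/z plays the role of p/u. The exchange identity with w = x0 reads u y p
      = p y u and makes c central; general w then shows that zDx and ca differ by a central
      element.\<close>
    define c where "c = p * u3"
    have Dp: "D p = 0" using commuting[of x x0] by (simp add: p_def commutator_jacobi[of a "D x" x0] D_D)
    have pu: "u3 * p = c" unfolding c_def by (rule kernel_commute[OF Du(2) Dp])
    have ex: "D w * y * p = commutator (D x) w * y * u" for w y
      unfolding p_def u_def by (rule D_exchange)
    have "z * commutator c y = 0" for y
    proof -
      have "u3 * (u * y * p) * u3 = u3 * (p * y * u) * u3"
        using ex[of x0 y] by (simp add: u_def p_def)
      moreover have "u3 * (u * y * p) * u3 = z * (y * c)"
        by (simp add: c_def mult.assoc flip: zu(1))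
      moreover have "u3 * (p * y * u) * u3 = c * y * z"
        by (simp add: pu[symmetric] mult.assoc flip: zu(2))
      moreover have "c * y * z = z * (c * y)" using centralD[OF z(1)] by metis
      ultimately show ?thesis by (simp add: commutator_eq distrib_left)
    qed
    then have c: "central c"
      using central_mult_eq_0[OF z(1)] z(2) central_iff_commutator by blast
    have "commutator (c * a + z * D x) w = 0" for w
    proof (rule eq_0_if_annihilates)
      fix y
      have "D w * y * c = D w * y * p * u3" by (simp add: c_def mult.assoc)
      also have "\<dots> = commutator (D x) w * y * z"
        unfolding ex by (simp add: mult.assoc zu)
      finally have "D w * y * c = commutator (D x) w * y * z" .
      then have "c * (D w * y) = z * (commutator (D x) w * y)"
        using centralD[OF c] centralD[OF z(1)] by metis
      then show "commutator (c * a + z * D x) w * y = 0"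
        using c z(1) by (simp add: commutator_add_left commutator_mult_left
            commutator_central_left distrib_right mult.assoc)
    qed
    then have "central (c * a + z * D x)" by (simp add: central_iff_commutator)
    moreover have "z * D x = c * a + (c * a + z * D x)" by simp
    ultimately show ?thesis unfolding lin_def using c by blast
  qed
  have lin_kernel: "lin (z * z * z * z * z * t)" if t: "D t = 0" for t
  proof -
    have "D (x0 * t) = u * t" using t by (simp add: D_mult u_def)
    then have l: "lin (z * u)" "lin (z * (u * t))"
      using lin_D[of x0] lin_D[of "x0 * t"] by (simp_all add: u_def)
    \<comment> \<open>As u^4 = z, this product equals z^5 t.\<close>
    have "lin (z * u * (z * u) * (z * u) * (z * (u * t)))"
      by (rule lin_mult[OF lin_mult[OF lin_mult[OF l(1) l(1)] l(1)] l(2)])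
    moreover have "z * u * (z * u) * (z * u) * (z * (u * t)) = z * z * z * z * (u * u * u * u * t)"
    proof -
      have "u * (z * y) = z * (u * y)" for y using centralD[OF z(1)] by (metis mult.assoc)
      then show ?thesis by (simp add: mult.assoc)
    qed
    ultimately show ?thesis by (simp add: mult.assoc flip: z_def) (simp add: z_def mult.assoc)
  qed
  define z6 where "z6 = z * z * z * z * z * z"
  show ?thesis
    unfolding central_rank_le_4_def
  proof (rule exI[of _ z6], rule exI[of _ a], rule exI[of _ x0], rule exI[of _ "x0 * a"],
      intro conjI allI)
    show "central z6" unfolding z6_def using z(1) by (intro central_mult)
    show "z6 \<noteq> 0" using central_mult_eq_0[OF z(1)] z(2) by (auto simp: z6_def mult.assoc)
  next
    fix x
    \<comment> \<open>Df = Dx u + u Dx = 0, so xu is x0 Dx plus a kernel element; multiplying by u^3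
      turns xu into zx. Together with z^5 from \<open>lin_kernel\<close> this accounts for
      \<open>z6\<close>.\<close>
    define f where "f = x * u + x0 * D x"
    have Df: "D f = 0"
      using D_commute[of x x0] by (simp add: f_def D_mult D_add D_D u_def)
    have "z * x = x * u * u3" using centralD[OF z(1)] by (simp add: mult.assoc zu)
    also have "x * u = x0 * D x + f" by (simp add: f_def ac_simps)
    finally have zx: "z * x = x0 * (D x * u3) + f * u3" by (simp add: distrib_right mult.assoc)
    obtain c d where c: "central c" "central d" "z * z * z * z * z * (D x * u3) = c * a + d"
      using lin_kernel[of "D x * u3"] unfolding lin_def by (auto simp: D_mult D_D Du)
    obtain c' d' where c': "central c'" "central d'" "z * z * z * z * z * (f * u3) = c' * a + d'"
      using lin_kernel[of "f * u3"] unfolding lin_def by (auto simp: D_mult Df Du)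
    have "z6 * x = z * z * z * z * z * (x0 * (D x * u3)) + z * z * z * z * z * (f * u3)"
      by (simp add: z6_def mult.assoc zx distrib_left)
    also have "z * z * z * z * z * (x0 * (D x * u3)) = x0 * (z * z * z * z * z * (D x * u3))"
    proof -
      have "central (z * z * z * z * z)" using z(1) by (intro central_mult)
      then show ?thesis by (metis centralD mult.assoc)
    qed
    finally have "z6 * x = d' + c' * a + d * x0 + c * (x0 * a)"
      using centralD[OF c(1), of x0] centralD[OF c(2), of x0] unfolding c(3) c'(3)
      by (simp add: distrib_left ac_simps flip: mult.assoc)
    then show "\<exists>c0 c1 c2 c3. central c0 \<and> central c1 \<and> central c2 \<and> central c3 \<and>
        z6 * x = c0 + c1 * a + c2 * x0 + c3 * (x0 * a)"
      using c(1,2) c'(1,2) by blast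
  qed
qed

end

section \<open>Rank at most 4 from an abelian noncentral submodule\<close>

context abelian_submodule_char_2
begin

text \<open>For D = [k,-], k(Dx)^4 = kxkxkxkxk is the fourth power of kxk in the corner kRk, which
  is a domain.\<close>

lemma commutator_image_nonnilpotent:
  assumes k: "k \<in> V" "k * k = 0" "k \<noteq> 0"
  shows "\<exists>x. commutator k x * commutator k x * commutator k x * commutator k x \<noteq> 0"
proof -
  obtain x where x: "k * x * k \<noteq> 0"
    using prime_rng[of k k] k(3) by blast
  have kk: "k * (k * y) = 0" for y using k(2) by (metis mult.assoc mult_zero_left)
  have "k * x * k * x * k \<noteq> 0"
    using corner_domain[OF k(1,2), of x x] x by blast
  then have "k * (x * k * x) * k \<noteq> 0" by (simp add: mult.assoc)
  then have "k * x * k * (x * k * x) * k \<noteq> 0"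
    using corner_domain[OF k(1,2), of x "x * k * x"] x by blast
  then have "k * (x * k * x * k * x) * k \<noteq> 0" by (simp add: mult.assoc)
  then have "k * x * k * (x * k * x * k * x) * k \<noteq> 0"
    using corner_domain[OF k(1,2), of x "x * k * x * k * x"] x by blast
  moreover have "k * (commutator k x * commutator k x * commutator k x * commutator k x) =
      k * x * k * (x * k * x * k * x) * k"
    by (simp add: commutator_eq algebra_simps kk k(2))
  ultimately show ?thesis by (metis mult_zero_right)
qed

lemma central_fourth_power_commutator:
  assumes "a \<in> V"
  shows "central (commutator a x * commutator a x * commutator a x * commutator a x)"
  using central_square[OF square_commutator_mem[OF assms]] by (simp add: mult.assoc)

text \<open>A nonzero square-zero k in V can replace a, thanks to its corner. If V has no such k,
  then a itself works: a nonzero (Dx)^2 for D = [a,-] lies in V, so its square is again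
  nonzero.\<close>

lemma central_rank_le_4_if_noncentral:
  assumes a: "a \<in> V" "\<not> central a"
  shows "central_rank_le_4 (TYPE('a))"
proof (cases "\<exists>k\<in>V. k * k = 0 \<and> k \<noteq> 0")
  case True
  then obtain k where k: "k \<in> V" "k * k = 0" "k \<noteq> 0" by blast
  have "\<not> central k" using central_mult_eq_0[of k k] k(2,3) by blast
  then interpret commuting_derivation_char_2 ty k
    using commutator_image_abelian[OF k(1,2)] by unfold_locales (simp_all add: k(2))
  obtain x where "commutator k x * commutator k x * commutator k x * commutator k x \<noteq> 0"
    using commutator_image_nonnilpotent[OF k] by blast
  then show ?thesis
    using central_rank_le_4 central_fourth_power_commutator[OF k(1)] by blast
next
  case False
  then have reduced: "v = 0" if "v \<in> V" "v * v = 0" for v using that by blast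
  interpret commuting_derivation_char_2 ty a
    using a(2) central_square[OF a(1)] commutator_image_abelian_if_reduced[OF a(1) reduced]
    by unfold_locales
  obtain x where "commutator a x * commutator a x \<noteq> 0" using exists_square_nonzero by blast
  then have "commutator a x * commutator a x * (commutator a x * commutator a x) \<noteq> 0"
    using reduced square_commutator_mem[OF a(1)] by blast
  then show ?thesis
    using central_rank_le_4 central_fourth_power_commutator[OF a(1)] by (simp add: mult.assoc)
qed

end

text \<open>The polynomial \<open>s4\<close> with its signs dropped, as is harmless in
  characteristic 2, and with type-class operations in place of a ring record.\<close>

definition permutation_sum4 :: "(nat \<Rightarrow> 'a::ring) \<Rightarrow> 'a" where
  "permutation_sum4 x = (\<Sum>\<sigma> | \<sigma> permutes {1..4}. x (\<sigma> 1) * x (\<sigma> 2) * x (\<sigma> 3) * x (\<sigma> 4))"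

lemma (in prime_rng_char_2) permutation_sum4_eq:
  "permutation_sum4 x = s4_char_2 (x 1) (x 2) (x 3) (x 4 :: 'a)"
proof -
  have "{1..4::nat} = {1, 2, 3, 4}" by auto
  then show ?thesis
    unfolding permutation_sum4_def
    by (simp add: sum_over_permutations_insert transpose_def s4_char_2_def commutator_eq algebra_simps)
qed

text \<open>This is what the main argument uses about prime rings. A prime ring has characteristic 2
  or no 2-torsion at all, so one of the two preceding analyses applies.\<close>

lemma central_if_commutators_central:
  fixes V :: "'a::prime_rng set"
  assumes V: "commutator_submodule V" and a: "a \<in> V"
    and cent: "\<And>a b. a \<in> V \<Longrightarrow> b \<in> V \<Longrightarrow> central (commutator a b)"
    and nonexceptional: "(\<forall>x :: 'a. x + x = 0) \<Longrightarrow> \<exists>x :: nat \<Rightarrow> 'a. permutation_sum4 x \<noteq> 0"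
  shows "central a"
proof (cases "\<forall>x :: 'a. x + x = 0")
  case True
  then interpret prime_rng_char_2 "TYPE('a)" by unfold_locales simp
  have rank: "\<not> central_rank_le_4 (TYPE('a))"
    using nonexceptional[OF True] s4_char_2_eq_0 by (auto simp: permutation_sum4_eq)
  then have "commutator a b = 0" if "a \<in> V" "b \<in> V" for a b
    using central_rank_le_4_if_nonabelian[OF V that _ cent] by blast
  then interpret abelian_submodule_char_2 "TYPE('a)" V
    by unfold_locales (rule V)
  show ?thesis
    using central_rank_le_4_if_noncentral[OF a] rank by blast
next
  case False
  then obtain y :: 'a where y: "y + y \<noteq> 0" by blast
  have torsion_free: "x = 0" if "x + x = 0" for x :: 'a
  proof -
    have "x * r * (y + y) = (x + x) * (r * y)" for r
      by (simp add: algebra_simps)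
    then show ?thesis using prime_rng[of x "y + y"] y that by auto
  qed
  have "commutator a (commutator a (commutator x z)) = 0" for x z
    by (rule commutator_submodule_abelian_if_torsion_free[OF V a commutator_submoduleD(6)[OF V a] cent
        torsion_free])
  then show ?thesis
    by (rule central_if_torsion_free[OF _ torsion_free])
qed

section \<open>Quotients by prime ideals\<close>

lemma two_sided_ideal_univ_ring_iff:
  "two_sided_ideal univ_ring I \<longleftrightarrow> 0 \<in> I \<and> (\<forall>x\<in>I. \<forall>y\<in>I. x - y \<in> I) \<and>
     (\<forall>a. \<forall>x\<in>I. a * x \<in> I \<and> x * a \<in> I)"
  unfolding two_sided_ideal_def additive_subgroup_univ_ring_iff by (auto simp: univ_ring_def)

lemma proper_ideal_univ_ring_iff:
  "proper_ideal univ_ring I \<longleftrightarrow> two_sided_ideal univ_ring I \<and> I \<noteq> UNIV"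
  by (simp add: proper_ideal_def univ_ring_def)

text \<open>The ideals \<open>I\<close> and \<open>J\<close> have product inside \<open>P\<close>,
  and \<open>I\<close> contains xA. As A need not have a unit, passing from xA \<subseteq> P to x
  \<in> P takes primeness once more, for \<open>M\<close> and A.\<close>

lemma prime_ideal_mult_mem:
  assumes P: "prime_ideal univ_ring P" and xy: "\<And>r. x * r * y \<in> P"
  shows "x \<in> P \<or> y \<in> (P :: 'a::ring set)"
proof -
  have ideal: "two_sided_ideal univ_ring P" and proper: "P \<noteq> UNIV"
    and prime: "\<And>I J. two_sided_ideal univ_ring I \<Longrightarrow> two_sided_ideal univ_ring J \<Longrightarrow>
      (\<And>x y. x \<in> I \<Longrightarrow> y \<in> J \<Longrightarrow> x * y \<in> P) \<Longrightarrow> I \<subseteq> P \<or> J \<subseteq> P"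
    using P unfolding prime_ideal_def proper_ideal_univ_ring_iff by (auto simp: univ_ring_def)
  note P = ideal[unfolded two_sided_ideal_univ_ring_iff]
  define J where "J = {y. \<forall>r. x * r * y \<in> P}"
  define I where "I = {x. \<forall>y\<in>J. x * y \<in> P}"
  define M where "M = {x. \<forall>r. x * r \<in> P}"
  have J: "two_sided_ideal univ_ring J"
  proof -
    have "x * r * (a * y) \<in> P" if "\<forall>r. x * r * y \<in> P" for a y r
      using that[rule_format, of "r * a"] by (simp add: mult.assoc)
    moreover have "x * r * (y * a) \<in> P" if "\<forall>r. x * r * y \<in> P" for a y r
      using P that by (simp flip: mult.assoc)
    ultimately show ?thesis
      unfolding two_sided_ideal_univ_ring_iff J_def using P by (auto simp: right_diff_distrib)
  qed
  then have "two_sided_ideal univ_ring I"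
    unfolding two_sided_ideal_univ_ring_iff I_def
    using P by (auto simp: left_diff_distrib mult.assoc)
  then have "I \<subseteq> P \<or> J \<subseteq> P"
    by (rule prime) (use J in \<open>auto simp: I_def\<close>)
  then show ?thesis
  proof
    assume "J \<subseteq> P"
    then show ?thesis using xy by (auto simp: J_def)
  next
    assume "I \<subseteq> P"
    moreover have "x * r \<in> I" for r by (simp add: I_def J_def)
    ultimately have "x \<in> M" by (auto simp: M_def)
    moreover have "two_sided_ideal univ_ring M"
      unfolding two_sided_ideal_univ_ring_iff M_def
      using P by (auto simp: left_diff_distrib mult.assoc)
    then have "M \<subseteq> P \<or> UNIV \<subseteq> P"
      by (rule prime) (auto simp: M_def two_sided_ideal_univ_ring_iff)
    ultimately show ?thesis using proper by blast
  qed
qed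


section \<open>The quotient record of a two-sided ideal\<close>

lemma univ_ring_simps [simp]:
  "carrier univ_ring = UNIV" "x \<otimes>\<^bsub>univ_ring\<^esub> y = x * y" "x \<oplus>\<^bsub>univ_ring\<^esub> y = x + y" "\<zero>\<^bsub>univ_ring\<^esub> = 0"
  by (simp_all add: univ_ring_def)

locale univ_ring_ideal =
  fixes P :: "'a::ring set"
  assumes ideal: "two_sided_ideal univ_ring P"
begin

abbreviation coset :: "'a \<Rightarrow> 'a set" where "coset x \<equiv> P +>\<^bsub>univ_ring\<^esub> x"
abbreviation Q :: "'a set ring" where "Q \<equiv> univ_ring Quot P"

lemma zero_mem: "0 \<in> P" and diff_mem: "x \<in> P \<Longrightarrow> y \<in> P \<Longrightarrow> x - y \<in> P"
  and mult_mem: "x \<in> P \<Longrightarrow> a * x \<in> P" "x \<in> P \<Longrightarrow> x * a \<in> P"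
  using ideal unfolding two_sided_ideal_univ_ring_iff by auto

lemma uminus_mem: "x \<in> P \<Longrightarrow> - x \<in> P"
  using diff_mem[OF zero_mem] by simp

lemma add_mem: "x \<in> P \<Longrightarrow> y \<in> P \<Longrightarrow> x + y \<in> P"
  using diff_mem[OF _ uminus_mem, of x y] by simp

lemma mem_coset_iff: "y \<in> coset x \<longleftrightarrow> y - x \<in> P"
  by (auto simp: a_r_coset_def r_coset_def univ_ring_def intro: bexI[of _ "y - x"])

lemma coset_eq_iff: "coset x = coset y \<longleftrightarrow> x - y \<in> P"
proof
  assume "coset x = coset y"
  then show "x - y \<in> P" using mem_coset_iff[of x x] zero_mem by (simp add: mem_coset_iff)
next
  assume xy: "x - y \<in> P"
  have "z - x \<in> P \<longleftrightarrow> z - y \<in> P" for z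
    using add_mem[OF _ xy, of "z - x"] diff_mem[OF _ xy, of "z - y"] by auto
  then show "coset x = coset y" by (auto simp: mem_coset_iff)
qed

lemma carrier_Q: "carrier Q = range coset"
  by (auto simp: FactRing_def A_RCOSETS_def RCOSETS_def a_r_coset_def univ_ring_def)

lemma mult_Q: "coset x \<otimes>\<^bsub>Q\<^esub> coset y = coset (x * y)"
proof -
  have "coset (a * b) = coset (x * y)" if "a \<in> coset x" "b \<in> coset y" for a b
  proof -
    have "a * b - x * y = (a - x) * b + x * (b - y)" by (simp add: algebra_simps)
    also have "\<dots> \<in> P" using that by (intro add_mem mult_mem) (simp_all add: mem_coset_iff)
    finally show ?thesis by (simp add: coset_eq_iff)
  qed
  moreover have "x \<in> coset x" "y \<in> coset y" by (simp_all add: mem_coset_iff zero_mem)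
  ultimately have "(\<Union>a\<in>coset x. \<Union>b\<in>coset y. coset (a * b)) = coset (x * y)"
    by blast
  then show ?thesis
    by (simp add: FactRing_def rcoset_mult_def)
qed

lemma add_Q: "coset x \<oplus>\<^bsub>Q\<^esub> coset y = coset (x + y)"
proof -
  have "\<exists>a\<in>coset x. \<exists>b\<in>coset y. z = a + b" if "z \<in> coset (x + y)" for z
    using that by (intro bexI[of _ x] bexI[of _ "z - x"])
      (simp_all add: mem_coset_iff zero_mem algebra_simps)
  moreover have "a + b \<in> coset (x + y)" if "a \<in> coset x" "b \<in> coset y" for a b
    using add_mem[of "a - x" "b - y"] that by (simp add: mem_coset_iff algebra_simps)
  ultimately have "(\<Union>a\<in>coset x. \<Union>b\<in>coset y. {a + b}) = coset (x + y)"
    by blast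
  then show ?thesis
    by (simp add: FactRing_def set_add_def set_mult_def)
qed

lemma zero_Q: "\<zero>\<^bsub>Q\<^esub> = coset 0"
  using mem_coset_iff[of _ 0] by (auto simp: FactRing_def)

lemma abelian_group_Q: "abelian_group Q"
proof (rule abelian_groupI)
  show "\<exists>y\<in>carrier Q. y \<oplus>\<^bsub>Q\<^esub> x = \<zero>\<^bsub>Q\<^esub>" if "x \<in> carrier Q" for x
  proof -
    obtain a where "x = coset a" using \<open>x \<in> carrier Q\<close> by (auto simp: carrier_Q)
    then show ?thesis
      by (intro bexI[of _ "coset (- a)"]) (simp_all add: add_Q zero_Q carrier_Q)
  qed
qed (auto simp: carrier_Q add_Q zero_Q ac_simps)

lemma uminus_Q: "\<ominus>\<^bsub>Q\<^esub> coset x = coset (- x)"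
proof -
  interpret abelian_group Q by (rule abelian_group_Q)
  show ?thesis by (rule minus_equality) (simp_all add: carrier_Q add_Q zero_Q)
qed

lemma finsum_Q: "finite A \<Longrightarrow> (\<Oplus>\<^bsub>Q\<^esub>i\<in>A. coset (f i)) = coset (sum f A)"
proof (induction A rule: finite_induct)
  case empty
  interpret abelian_group Q by (rule abelian_group_Q)
  show ?case by (simp add: zero_Q)
next
  case (insert i A)
  interpret abelian_group Q by (rule abelian_group_Q)
  show ?case using insert by (subst finsum_insert) (auto simp: carrier_Q add_Q)
qed

text \<open>Ideals of the quotient pull back along \<open>coset\<close>, and primeness of
  \<open>P\<close> is applied to the preimages.\<close>

lemma prime_ring_Q:
  assumes "prime_ideal univ_ring P"
  shows "prime_ring Q"
proof -
  interpret abelian_group Q by (rule abelian_group_Q)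
  have proper: "P \<noteq> UNIV"
    and prime: "\<And>I J. two_sided_ideal univ_ring I \<Longrightarrow> two_sided_ideal univ_ring J \<Longrightarrow>
      (\<And>x y. x \<in> I \<Longrightarrow> y \<in> J \<Longrightarrow> x * y \<in> P) \<Longrightarrow> I \<subseteq> P \<or> J \<subseteq> P"
    using assms unfolding prime_ideal_def proper_ideal_univ_ring_iff by (auto simp: univ_ring_def)
  have vimage: "two_sided_ideal univ_ring (coset -` I)" if I: "two_sided_ideal Q I" for I
  proof -
    interpret I: additive_subgroup I Q using I by (simp add: two_sided_ideal_def)
    have "coset x \<ominus>\<^bsub>Q\<^esub> coset y = coset (x - y)" for x y
      by (simp add: a_minus_def uminus_Q add_Q)
    moreover have "x \<ominus>\<^bsub>Q\<^esub> y \<in> I" if "x \<in> I" "y \<in> I" for x y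
      using that by (simp add: minus_eq)
    moreover have "coset (a * x) \<in> I \<and> coset (x * a) \<in> I" if "coset x \<in> I" for a x
      using I that unfolding two_sided_ideal_def carrier_Q mult_Q[symmetric] by blast
    ultimately show ?thesis
      unfolding two_sided_ideal_univ_ring_iff using I.zero_closed by (auto simp: zero_Q) metis
  qed
  have zero_ideal: "two_sided_ideal Q {\<zero>\<^bsub>Q\<^esub>}"
  proof -
    have "additive_subgroup {\<zero>\<^bsub>Q\<^esub>} Q"
      by (intro additive_subgroup.intro add.subgroupI) (auto simp: a_inv_def[symmetric])
    then show ?thesis
      unfolding two_sided_ideal_def by (auto simp: carrier_Q zero_Q mult_Q)
  qed
  have "{\<zero>\<^bsub>Q\<^esub>} \<noteq> carrier Q"
  proof
    assume "{\<zero>\<^bsub>Q\<^esub>} = carrier Q"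
    then have "coset x = coset 0" for x by (auto simp: carrier_Q zero_Q)
    then show False using proper by (auto simp: coset_eq_iff)
  qed
  moreover have "I \<subseteq> {\<zero>\<^bsub>Q\<^esub>} \<or> J \<subseteq> {\<zero>\<^bsub>Q\<^esub>}"
    if I: "two_sided_ideal Q I" and J: "two_sided_ideal Q J"
      and IJ: "\<forall>x\<in>I. \<forall>y\<in>J. x \<otimes>\<^bsub>Q\<^esub> y \<in> {\<zero>\<^bsub>Q\<^esub>}" for I J
  proof -
    have "coset -` I \<subseteq> P \<or> coset -` J \<subseteq> P"
    proof (rule prime[OF vimage[OF I] vimage[OF J]])
      fix x y assume "x \<in> coset -` I" "y \<in> coset -` J"
      then have "coset x \<otimes>\<^bsub>Q\<^esub> coset y = \<zero>\<^bsub>Q\<^esub>" using IJ by blast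
      then have "coset (x * y) = coset 0" by (simp only: mult_Q zero_Q)
      then show "x * y \<in> P" by (simp add: coset_eq_iff)
    qed
    moreover have "K \<subseteq> {\<zero>\<^bsub>Q\<^esub>}" if K: "two_sided_ideal Q K" "coset -` K \<subseteq> P" for K
    proof
      fix x assume "x \<in> K"
      moreover from this obtain a where "x = coset a"
        using K(1) additive_subgroup.a_Hcarr unfolding two_sided_ideal_def by (metis carrier_Q imageE)
      ultimately show "x \<in> {\<zero>\<^bsub>Q\<^esub>}" using K(2) by (auto simp: zero_Q coset_eq_iff)
    qed
    ultimately show ?thesis using I J by blast
  qed
  ultimately show ?thesis
    unfolding prime_ring_def prime_ideal_def proper_ideal_def using zero_ideal by blast
qed

text \<open>If the quotient has characteristic 2, signs act trivially on cosets, so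
  \<open>s4\<close> of cosets is the coset of \<open>permutation_sum4\<close>.\<close>

lemma exceptional_ring_Q:
  assumes "prime_ideal univ_ring P" and double: "\<And>x. x + x \<in> P"
    and s4: "\<And>x. permutation_sum4 x \<in> P"
  shows "exceptional_ring Q"
proof -
  interpret abelian_group Q by (rule abelian_group_Q)
  have sign: "[sign \<sigma>] \<cdot>\<^bsub>Q\<^esub> coset x = coset x" for \<sigma> :: "nat \<Rightarrow> nat" and x
  proof -
    have c: "coset x \<in> carrier Q" by (simp add: carrier_Q)
    have "\<ominus>\<^bsub>Q\<^esub> coset x = coset x"
      using uminus_mem[OF double[of x]] by (simp add: uminus_Q coset_eq_iff)
    then have "[(- 1 :: int)] \<cdot>\<^bsub>Q\<^esub> coset x = coset x"
      using add.int_pow_neg[OF c, of 1] add.int_pow_1[OF c] by (simp only:)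
    then show ?thesis
      using add.int_pow_1[OF c] by (simp add: sign_def)
  qed
  have "s4 Q x = \<zero>\<^bsub>Q\<^esub>" if x: "\<forall>i\<in>{1..4}. x i \<in> carrier Q" for x
  proof -
    obtain y where y: "\<And>i. i \<in> {1..4} \<Longrightarrow> x i = coset (y i)"
      using x unfolding carrier_Q image_iff by metis
    have perm: "x (\<sigma> i) = coset (y (\<sigma> i))" if "\<sigma> permutes {1..4}" "i \<in> {1..4}" for \<sigma> i
      using y permutes_in_image[OF that(1)] that(2) by blast
    have "s4 Q x = (\<Oplus>\<^bsub>Q\<^esub>\<sigma>\<in>{\<sigma>. \<sigma> permutes {1..4}}. coset (y (\<sigma> 1) * y (\<sigma> 2) * y (\<sigma> 3) * y (\<sigma> 4)))"
      unfolding s4_def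
      by (rule finsum_cong') (auto simp: perm mult_Q sign carrier_Q)
    also have "\<dots> = coset (permutation_sum4 y)"
      unfolding permutation_sum4_def by (rule finsum_Q) (simp add: finite_permutations)
    also have "\<dots> = \<zero>\<^bsub>Q\<^esub>" by (simp add: zero_Q coset_eq_iff s4)
    finally show ?thesis .
  qed
  then show ?thesis
    unfolding exceptional_ring_def using prime_ring_Q[OF assms(1)]
    by (auto simp: carrier_Q add_Q zero_Q coset_eq_iff double)
qed

end

lemma nonexceptional_prime_idealE:
  assumes "nonexceptional_prime_ideal P" "\<And>x. x + x \<in> P"
  obtains x where "permutation_sum4 x \<notin> P"
proof -
  have P: "prime_ideal univ_ring P" "\<not> exceptional_ring (univ_ring Quot P)"
    using assms(1) by (auto simp: nonexceptional_prime_ideal_def exceptional_prime_ideal_def)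
  interpret univ_ring_ideal P
    by unfold_locales (use P(1) in \<open>simp add: prime_ideal_def proper_ideal_def\<close>)
  show ?thesis using exceptional_ring_Q[OF P(1) assms(2)] P(2) that by blast
qed

definition central_modulo :: "'a::ring set \<Rightarrow> 'a \<Rightarrow> bool" where
  "central_modulo P x \<longleftrightarrow> (\<forall>y. commutator x y \<in> P)"

text \<open>The conclusion of \<open>central_if_commutators_central\<close> for A/P, phrased with
  submodules of A so that it does not mention a quotient type.\<close>

definition commutators_detect_central :: "'a::ring set \<Rightarrow> bool" where
  "commutators_detect_central P \<longleftrightarrow> (\<forall>V. commutator_submodule V \<longrightarrow>
     (\<forall>a\<in>V. \<forall>b\<in>V. central_modulo P (commutator a b)) \<longrightarrow> (\<forall>a\<in>V. central_modulo P a))"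

text \<open>
  A type cannot depend on an ideal, but it can depend on an ideal chosen once and for all for the
  type \<open>'a\<close>. To prove \<^const>\<open>commutators_detect_central\<close> for all non-exceptional primes it suffices
  to treat one that is a counterexample if there is any.
\<close>

definition bad_prime :: "'a::ring set" where
  "bad_prime = (if \<exists>P :: 'a set. nonexceptional_prime_ideal P \<and> \<not> commutators_detect_central P
     then SOME P. nonexceptional_prime_ideal P \<and> \<not> commutators_detect_central P else UNIV)"

text \<open>The default value \<open>UNIV\<close> occurs if there is no counterexample; the quotient
  is then the zero ring.\<close>

lemma bad_prime_cases:
  "bad_prime = (UNIV :: 'a::ring set) \<or> prime_ideal univ_ring (bad_prime :: 'a set)"
proof -
  have "nonexceptional_prime_ideal (SOME P :: 'a set. nonexceptional_prime_ideal P \<and> \<not> commutators_detect_central P)"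
    if "\<exists>P :: 'a set. nonexceptional_prime_ideal P \<and> \<not> commutators_detect_central P"
    using someI_ex[OF that] by blast
  then show ?thesis
    by (auto simp: bad_prime_def nonexceptional_prime_ideal_def)
qed

lemma two_sided_ideal_bad_prime: "two_sided_ideal univ_ring bad_prime"
  using bad_prime_cases
  by (auto simp: two_sided_ideal_univ_ring_iff prime_ideal_def proper_ideal_univ_ring_iff)

interpretation bad_prime: univ_ring_ideal bad_prime
  by unfold_locales (rule two_sided_ideal_bad_prime)

quotient_type (overloaded) 'a bad_quotient = "'a::ring" / "\<lambda>x y. x - y \<in> bad_prime"
proof (rule equivpI)
  show "reflp (\<lambda>x y :: 'a. x - y \<in> bad_prime)"
    by (rule reflpI) (simp add: bad_prime.zero_mem)
  show "symp (\<lambda>x y :: 'a. x - y \<in> bad_prime)"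
    by (rule sympI) (metis bad_prime.uminus_mem minus_diff_eq)
  show "transp (\<lambda>x y :: 'a. x - y \<in> bad_prime)"
    by (rule transpI) (metis bad_prime.add_mem diff_add_cancel add_diff_eq)
qed

instantiation bad_quotient :: (ring) prime_rng
begin

lift_definition zero_bad_quotient :: "'a bad_quotient" is 0 .
lift_definition plus_bad_quotient :: "'a bad_quotient \<Rightarrow> 'a bad_quotient \<Rightarrow> 'a bad_quotient" is "(+)"
  by (metis add_diff_add bad_prime.add_mem)
lift_definition uminus_bad_quotient :: "'a bad_quotient \<Rightarrow> 'a bad_quotient" is uminus
  by (metis bad_prime.uminus_mem minus_diff_minus)
lift_definition minus_bad_quotient :: "'a bad_quotient \<Rightarrow> 'a bad_quotient \<Rightarrow> 'a bad_quotient" is "(-)"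
  by (metis bad_prime.diff_mem diff_diff_eq2 diff_add_eq diff_diff_eq add_diff_eq add.commute)
lift_definition times_bad_quotient :: "'a bad_quotient \<Rightarrow> 'a bad_quotient \<Rightarrow> 'a bad_quotient" is "(*)"
proof -
  fix x x' y y' :: 'a
  assume "x - x' \<in> bad_prime" "y - y' \<in> bad_prime"
  moreover have "x * y - x' * y' = (x - x') * y + x' * (y - y')"
    by (simp add: algebra_simps)
  ultimately show "x * y - x' * y' \<in> bad_prime"
    by (metis bad_prime.add_mem bad_prime.mult_mem)
qed

instance
proof
  fix x y :: "'a bad_quotient"
  assume "\<And>r. x * r * y = 0"
  then show "x = 0 \<or> y = 0"
  proof (transfer)
    fix x y :: 'a
    assume "\<And>r. x * r * y - 0 \<in> bad_prime"
    then show "x - 0 \<in> bad_prime \<or> y - 0 \<in> bad_prime"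
      using bad_prime_cases[where 'a = 'a] prime_ideal_mult_mem[of bad_prime x y] by auto
  qed
qed (transfer; simp add: algebra_simps bad_prime.zero_mem)+

end

lemma abs_bad_quotient_simps:
  "abs_bad_quotient (x + y) = abs_bad_quotient x + abs_bad_quotient y"
  "abs_bad_quotient (x - y) = abs_bad_quotient x - abs_bad_quotient y"
  "abs_bad_quotient (x * y) = abs_bad_quotient x * abs_bad_quotient y"
  "abs_bad_quotient 0 = 0"
  by (simp_all add: plus_bad_quotient.abs_eq minus_bad_quotient.abs_eq times_bad_quotient.abs_eq
      zero_bad_quotient_def)

lemma abs_bad_quotient_eq_0_iff: "abs_bad_quotient x = 0 \<longleftrightarrow> x \<in> bad_prime"
  by (simp add: zero_bad_quotient_def bad_quotient.abs_eq_iff)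

lemma abs_bad_quotient_surj: "\<exists>x. y = abs_bad_quotient x"
  by (metis Quotient_abs_rep Quotient_bad_quotient)

lemma abs_bad_quotient_commutator:
  "abs_bad_quotient (commutator x y) = commutator (abs_bad_quotient x) (abs_bad_quotient y)"
  by (simp add: commutator_def abs_bad_quotient_simps)

lemma abs_bad_quotient_sum: "abs_bad_quotient (sum f A) = (\<Sum>i\<in>A. abs_bad_quotient (f i))"
  by (induction A rule: infinite_finite_induct) (simp_all add: abs_bad_quotient_simps)

lemma abs_bad_quotient_permutation_sum4:
  "abs_bad_quotient (permutation_sum4 x) = permutation_sum4 (\<lambda>i. abs_bad_quotient (x i))"
  by (simp add: permutation_sum4_def abs_bad_quotient_sum abs_bad_quotient_simps)

lemma central_abs_bad_quotient_iff:
  "central (abs_bad_quotient x) \<longleftrightarrow> central_modulo bad_prime x"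
proof -
  have "(\<forall>y. commutator (abs_bad_quotient x) y = 0) \<longleftrightarrow>
      (\<forall>y. abs_bad_quotient (commutator x y) = 0)"
    by (metis abs_bad_quotient_commutator abs_bad_quotient_surj)
  then show ?thesis
    by (simp add: central_iff_commutator central_modulo_def abs_bad_quotient_eq_0_iff)
qed

text \<open>A counterexample \<open>P\<close> would make \<open>bad_prime\<close> a counterexample
  too. Its submodule is mapped to the type \<open>bad_quotient\<close>, where
  \<open>central_if_commutators_central\<close> applies.\<close>

lemma commutators_detect_central:
  assumes "nonexceptional_prime_ideal P"
  shows "commutators_detect_central (P :: 'a::ring set)"
proof (rule ccontr)
  assume "\<not> commutators_detect_central P"
  with assms have ex: "\<exists>P :: 'a set. nonexceptional_prime_ideal P \<and> \<not> commutators_detect_central P"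
    by blast
  have bad: "nonexceptional_prime_ideal (bad_prime :: 'a set)"
    and "\<not> commutators_detect_central (bad_prime :: 'a set)"
    using someI_ex[OF ex] ex by (simp_all add: bad_prime_def)
  then obtain V a where V: "commutator_submodule V" and a: "a \<in> V"
    and cent: "\<And>a b. a \<in> V \<Longrightarrow> b \<in> V \<Longrightarrow> central_modulo bad_prime (commutator a b)"
    and noncentral: "\<not> central_modulo bad_prime (a :: 'a)"
    unfolding commutators_detect_central_def by blast
  have "central (abs_bad_quotient a)"
  proof (rule central_if_commutators_central)
    show "commutator_submodule (abs_bad_quotient ` V)"
      unfolding commutator_submodule_iff
    proof (intro conjI ballI allI)
      show "0 \<in> abs_bad_quotient ` V"
        using commutator_submoduleD(1)[OF V] by (metis abs_bad_quotient_simps(4) imageI)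
    next
      fix x y :: "'a bad_quotient"
      assume "x \<in> abs_bad_quotient ` V" "y \<in> abs_bad_quotient ` V"
      then obtain x' y' where "x = abs_bad_quotient x'" "y = abs_bad_quotient y'" "x' \<in> V" "y' \<in> V"
        by blast
      then show "x - y \<in> abs_bad_quotient ` V"
        using commutator_submoduleD(2)[OF V] by (metis abs_bad_quotient_simps(2) imageI)
    next
      fix x y v :: "'a bad_quotient"
      assume "v \<in> abs_bad_quotient ` V"
      moreover obtain x' y' where "x = abs_bad_quotient x'" "y = abs_bad_quotient y'"
        using abs_bad_quotient_surj by metis
      ultimately show "commutator (commutator x y) v \<in> abs_bad_quotient ` V"
        using commutator_submoduleD(5)[OF V] by (auto simp flip: abs_bad_quotient_commutator)
    qed
    show "abs_bad_quotient a \<in> abs_bad_quotient ` V" using a by blast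
  next
    fix x y :: "'a bad_quotient"
      assume "x \<in> abs_bad_quotient ` V" "y \<in> abs_bad_quotient ` V"
    then show "central (commutator x y)"
      using cent by (auto simp: central_abs_bad_quotient_iff simp flip: abs_bad_quotient_commutator)
  next
    assume "\<forall>x :: 'a bad_quotient. x + x = 0"
    then have "x + x \<in> bad_prime" for x :: 'a
      by (simp add: abs_bad_quotient_simps flip: abs_bad_quotient_eq_0_iff)
    then obtain x :: "nat \<Rightarrow> 'a" where "permutation_sum4 x \<notin> bad_prime"
      using nonexceptional_prime_idealE[OF bad] by blast
    then show "\<exists>x :: nat \<Rightarrow> 'a bad_quotient. permutation_sum4 x \<noteq> 0"
      by (metis abs_bad_quotient_eq_0_iff abs_bad_quotient_permutation_sum4)
  qed
  with noncentral show False by (simp add: central_abs_bad_quotient_iff)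
qed

section \<open>Submodules over the commutators\<close>

definition commutator_transporter :: "'a::ring set \<Rightarrow> 'a set" where
  "commutator_transporter V = {x. \<forall>y. commutator x y \<in> V}"

text \<open>By the Jacobi identity, [[l,t],r] = [l,[t,r]] - [t,[l,r]] for l = [x,y]; both terms lie
  in V if [t,A] \<subseteq> V.\<close>

lemma commutator_submodule_transporter:
  assumes V: "commutator_submodule V"
  shows "commutator_submodule (commutator_transporter V)"
proof -
  note V' = commutator_submoduleD[OF V]
  have "commutator (commutator (commutator x y) t) r \<in> V" if t: "\<forall>y. commutator t y \<in> V" for x y t r
  proof -
    have "commutator (commutator (commutator x y) t) r =
        commutator (commutator x y) (commutator t r) - commutator t (commutator (commutator x y) r)"
      by (simp add: commutator_jacobi[of "commutator x y" t r])
    then show ?thesis using V'(2) V'(5) t by simp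
  qed
  then show ?thesis
    using V'(1,2) unfolding commutator_submodule_iff commutator_transporter_def
    by (simp add: commutator_diff_left)
qed

lemma commutator_mem_transporter:
  assumes V: "commutator_submodule V" and "u \<in> V" "v \<in> V"
  shows "commutator u v \<in> commutator_transporter V"
proof -
  have "commutator (commutator u v) r = commutator u (commutator v r) - commutator v (commutator u r)" for r
    by (simp add: commutator_jacobi[of u v r])
  then show ?thesis
    using commutator_submoduleD(2,6)[OF V] assms(2,3) by (simp add: commutator_transporter_def)
qed

text \<open>Brackets with a product reduce to brackets with its factors, so the transporter of a
  submodule is closed under products.\<close>

lemma commutator_mult_left_cyclic: "commutator (x * y) r = commutator x (y * r) + commutator y (r * x)"
  by (simp add: commutator_def mult.assoc)

lemma commutators_mem_if_commutator_submodule: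
  fixes V :: "'a::ring set"
  assumes V: "commutator_submodule V"
    and proper_ideals: "\<And>I :: 'a set. proper_ideal univ_ring I \<Longrightarrow>
      \<exists>P. nonexceptional_prime_ideal P \<and> I \<subseteq> P"
    and noncentral: "fully_noncentral V"
  shows "commutator x y \<in> V"
proof -
  define T where "T = commutator_transporter V"
  define T' where "T' = commutator_transporter T"
  have T: "commutator_submodule T" and T': "commutator_submodule T'"
    by (simp_all add: T'_def T_def V commutator_submodule_transporter)
  have T_D: "commutator t y \<in> V" "commutator y t \<in> V" if "t \<in> T" for t y
  proof -
    show "commutator t y \<in> V" using that by (simp add: T_def commutator_transporter_def)
    from commutator_submoduleD(4)[OF V this] show "commutator y t \<in> V"
      by (simp add: commutator_def)
  qed
  have T_I: "t \<in> T" if "\<And>y. commutator t y \<in> V" for t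
    using that by (simp add: T_def commutator_transporter_def)
  have T'_D: "commutator t y \<in> T" if "t \<in> T'" for t y
    using that by (simp add: T'_def commutator_transporter_def)
  have T_mult: "s * t \<in> T" if "s \<in> T" "t \<in> T" for s t
    by (rule T_I) (simp add: commutator_mult_left_cyclic[of s t] commutator_submoduleD(3)[OF V] T_D that)
  have T_left: "x * t \<in> T" if "t \<in> T" "\<And>y. t * y \<in> T" for x t
    by (rule T_I) (simp add: commutator_mult_left_cyclic[of x t] commutator_submoduleD(3)[OF V] T_D that)
  have T_right: "commutator u v * x \<in> T" if u: "u \<in> T'" and v: "v \<in> T" for u v x
  proof -
    \<comment> \<open>Here [u,v]x = [u,vx] - v[u,x], and the second product is split cyclically.
      Every bracket that results has an entry in T, namely [u,vx], v or [u,x].\<close>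
    have "commutator (commutator u v * x) y = commutator (commutator u (v * x)) y -
        (commutator v (commutator u x * y) + commutator (commutator u x) (y * v))" for y
      by (simp add: commutator_mult_right[of u v x] commutator_add_left
          commutator_mult_left_cyclic[of v "commutator u x"])
    moreover have "commutator (commutator u (v * x)) y -
        (commutator v (commutator u x * y) + commutator (commutator u x) (y * v)) \<in> V" for y
      by (intro commutator_submoduleD(2,3)[OF V] T_D T'_D u v)
    ultimately show ?thesis
      by (intro T_I) simp
  qed
  \<comment> \<open>The largest ideal inside T; all four kinds of multiples are listed because A
    need not have a unit.\<close>
  define I where "I = {z. z \<in> T \<and> (\<forall>y. z * y \<in> T) \<and> (\<forall>x. x * z \<in> T) \<and> (\<forall>x y. x * (z * y) \<in> T)}"
  have ideal: "two_sided_ideal univ_ring I"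
    unfolding two_sided_ideal_univ_ring_iff
  proof (intro conjI ballI allI)
    fix a z assume z: "z \<in> I"
    have "x * (a * z) \<in> T" "x * (a * (z * y)) \<in> T" for x y
      using z by (simp_all add: I_def flip: mult.assoc[of x a])
    then show "a * z \<in> I" using z by (simp add: I_def mult.assoc)
    show "z * a \<in> I" using z by (simp add: I_def mult.assoc)
  qed (use commutator_submoduleD(1,2)[OF T] in \<open>simp_all add: I_def left_diff_distrib right_diff_distrib\<close>)
  have I_mem: "commutator u v \<in> I" if u: "u \<in> T'" and v: "v \<in> T" for u v
  proof -
    have q: "commutator u v * x * y \<in> T" for x y
      using T_right[OF u v, of "x * y"] by (simp add: mult.assoc)
    have "x * (commutator u v * y) \<in> T" for x y
      by (rule T_left[OF T_right[OF u v] q])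
    then show ?thesis
      unfolding I_def using T'_D[OF u] T_right[OF u v] T_left[OF T'_D[OF u] T_right[OF u v]]
      by (simp add: mult.assoc)
  qed
  have "I = UNIV"
  proof (rule ccontr)
    assume "I \<noteq> UNIV"
    then obtain P where P: "nonexceptional_prime_ideal P" and IP: "I \<subseteq> P"
      using proper_ideals ideal unfolding proper_ideal_univ_ring_iff by blast
    have P_ideal: "proper_ideal univ_ring P"
      using P by (simp add: nonexceptional_prime_ideal_def prime_ideal_def)
    then interpret univ_ring_ideal P
      by unfold_locales (simp add: proper_ideal_def)
    have detect: "central_modulo P a"
      if "commutator_submodule U" "\<And>a b. a \<in> U \<Longrightarrow> b \<in> U \<Longrightarrow> central_modulo P (commutator a b)" "a \<in> U"
      for U a
      using commutators_detect_central[OF P] that unfolding commutators_detect_central_def by blast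
    have commutator_mem: "commutator p y \<in> P" "commutator y p \<in> P" if "p \<in> P" for p y
      using that by (simp_all add: commutator_def diff_mem mult_mem)
    \<comment> \<open>The center of T modulo P. It is a submodule with [W,W] \<subseteq> P, hence
      central modulo P by \<open>detect\<close>.\<close>
    define W where "W = {w \<in> T. \<forall>t\<in>T. commutator w t \<in> P}"
    have "commutator_submodule W"
    proof -
      have "commutator (commutator (commutator x y) w) t \<in> P"
        if w: "w \<in> T" "\<forall>t\<in>T. commutator w t \<in> P" and t: "t \<in> T" for x y w t
      proof -
        have "commutator (commutator (commutator x y) w) t =
          commutator (commutator x y) (commutator w t) - commutator w (commutator (commutator x y) t)"
          by (simp add: commutator_jacobi[of "commutator x y" w t])
        also have "\<dots> \<in> P"
          using w(2) t commutator_submoduleD(5)[OF T t] by (intro diff_mem[OF commutator_mem(2)]) blast+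
        finally show ?thesis .
      qed
      then show ?thesis
        unfolding commutator_submodule_iff W_def using commutator_submoduleD(1,2,5)[OF T]
        by (auto simp: commutator_diff_left zero_mem diff_mem)
    qed
    then have W: "central_modulo P w" if "w \<in> W" for w
      by (rule detect) (use that in \<open>auto simp: W_def central_modulo_def commutator_mem\<close>)
    \<comment> \<open>[s,t] lies in the subring T and also in T', so [[s,t],T] \<subseteq> I
      \<subseteq> P by \<open>I_mem\<close>.\<close>
    have "commutator s t \<in> W" if st: "s \<in> T" "t \<in> T" for s t
    proof -
      have "commutator s t \<in> T"
        using commutator_submoduleD(2)[OF T] T_mult st by (simp add: commutator_def)
      moreover have "commutator s t \<in> T'"
        unfolding T'_def by (rule commutator_mem_transporter[OF T st])
      ultimately show ?thesis using I_mem IP by (auto simp: W_def)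
    qed
    then have T_central: "central_modulo P t" if "t \<in> T" for t
      by (intro detect[OF T _ that] W)
    \<comment> \<open>T is now central modulo P and contains [V,V], so V is central modulo P as
      well. This puts [A,V] inside the proper ideal P.\<close>
    have "commutator a b \<in> T" if "a \<in> V" "b \<in> V" for a b
      unfolding T_def by (rule commutator_mem_transporter[OF V that])
    then have "central_modulo P v" if "v \<in> V" for v
      by (intro detect[OF V _ that] T_central)
    then have "commutator g v \<in> P" if "v \<in> V" for g v
      using that uminus_mem by (metis central_modulo_def commutator_swap)
    then have "commutator_subgroup UNIV V \<subseteq> P"
      by (subst commutator_subgroup_subset_iff) (auto simp: zero_mem diff_mem)
    then show False
      using noncentral P_ideal unfolding fully_noncentral_def full_def by blast
  qed
  then have "x \<in> I" by simp
  then show ?thesis using T_D by (simp add: I_def)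
qed


section \<open>Inner automorphisms\<close>

lemma abelian_group_univ_ring: "abelian_group (univ_ring :: 'a::ring ring)"
proof (rule abelian_groupI)
  show "\<exists>y\<in>carrier univ_ring. y \<oplus>\<^bsub>univ_ring\<^esub> x = \<zero>\<^bsub>univ_ring\<^esub>" for x :: 'a
    by (rule bexI[of _ "- x"]) simp_all
qed (simp_all add: ac_simps)

abbreviation zmult :: "int \<Rightarrow> 'a::ring \<Rightarrow> 'a" where
  "zmult m x \<equiv> [m] \<cdot>\<^bsub>univ_ring\<^esub> x"

lemma zmult_simps [simp]:
  fixes x y :: "'a::ring"
  shows "zmult 0 x = 0" "zmult 1 x = x" "zmult (m + n) x = zmult m x + zmult n x"
  "zmult m (0 :: 'a) = 0" "zmult m (x + y) = zmult m x + zmult m y" "zmult (m * n) x = zmult m (zmult n x)"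
proof -
  interpret abelian_group "univ_ring :: 'a ring" by (rule abelian_group_univ_ring)
  show "zmult 0 x = 0" by (simp add: add_pow_def)
  show "zmult 1 x = x" using add.int_pow_1[of x] by simp
  show "zmult (m + n) x = zmult m x + zmult n x" using add.int_pow_mult[of x m n] by simp
  show "zmult m (x + y) = zmult m x + zmult m y" using add.int_pow_distrib[of x y m] by simp
  show "zmult m (0 :: 'a) = 0" using add.int_pow_one[of m] by simp
  show "zmult (m * n) x = zmult m (zmult n x)"
    using add.int_pow_pow[of x m n] by (simp add: mult.commute[of m n])
qed

lemma zmult_mult: "zmult m x * y = zmult m (x * y)" "x * zmult m y = zmult m (x * y)"
proof -
  have diff: "zmult (m - 1) x = zmult m x - x" for m and x :: 'a
    using zmult_simps(3)[of "m - 1" 1 x] by (simp del: zmult_simps(3))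
  show "zmult m x * y = zmult m (x * y)"
    by (induction m rule: int_induct[where k = 0]) (simp_all add: diff algebra_simps)
  show "x * zmult m y = zmult m (x * y)"
    by (induction m rule: int_induct[where k = 0]) (simp_all add: diff algebra_simps)
qed

lemma the_unit_element: "is_unit_element e \<Longrightarrow> (THE e. is_unit_element e) = e"
  by (rule the_equality) (simp, metis is_unit_element_def)

lemma min_unitization_simps:
  "(m, x) \<otimes>\<^bsub>min_unitization\<^esub> (n, y) = (m * n, zmult m y + zmult n x + x * y)"
  "(m, x) \<oplus>\<^bsub>min_unitization\<^esub> (n, y) = (m + n, x + y)"
  "\<zero>\<^bsub>min_unitization\<^esub> = (0, 0)"
  by (simp_all add: min_unitization_def)

lemma min_unitization_carrier:
  "(m, x :: 'a::ring) \<in> carrier min_unitization \<longleftrightarrow> m = 0 \<or> (\<nexists>e :: 'a. is_unit_element e)"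
  by (auto simp: min_unitization_def)

lemma ring_min_unitization: "ring (min_unitization :: (int \<times> 'a::ring) ring)"
proof (rule ringI)
  show "abelian_group (min_unitization :: (int \<times> 'a) ring)"
  proof (rule abelian_groupI)
    show "\<exists>y\<in>carrier min_unitization. y \<oplus>\<^bsub>min_unitization\<^esub> x = \<zero>\<^bsub>min_unitization\<^esub>"
      if "x \<in> carrier (min_unitization :: (int \<times> 'a) ring)" for x
      using that by (cases x) (rule bexI[of _ "(- fst x, - snd x)"],
          auto simp: min_unitization_simps min_unitization_carrier)
  qed (auto simp: min_unitization_simps min_unitization_carrier ac_simps)
  have one: "\<one>\<^bsub>min_unitization\<^esub> \<in> carrier (min_unitization :: (int \<times> 'a) ring) \<and>
      \<one>\<^bsub>min_unitization\<^esub> \<otimes>\<^bsub>min_unitization\<^esub> v = v \<and> v \<otimes>\<^bsub>min_unitization\<^esub> \<one>\<^bsub>min_unitization\<^esub> = v"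
    if "v \<in> carrier (min_unitization :: (int \<times> 'a) ring)" for v
  proof (cases "\<exists>e :: 'a. is_unit_element e")
    case True
    then obtain e :: 'a where e: "is_unit_element e" by blast
    then have "\<one>\<^bsub>min_unitization\<^esub> = (0, e)"
      using True by (simp add: min_unitization_def the_unit_element)
    then show ?thesis
      using that e True by (cases v)
        (auto simp: min_unitization_simps min_unitization_carrier is_unit_element_def)
  next
    case False
    then have "\<one>\<^bsub>min_unitization\<^esub> = (1, 0 :: 'a)" by (simp add: min_unitization_def)
    then show ?thesis
      using that False by (cases v) (auto simp: min_unitization_simps min_unitization_carrier)
  qed
  show "Group.monoid (min_unitization :: (int \<times> 'a) ring)"
  proof (rule monoidI)
    show "\<one>\<^bsub>min_unitization\<^esub> \<in> carrier (min_unitization :: (int \<times> 'a) ring)"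
      using one[of "(0, 0)"] by (simp add: min_unitization_carrier)
  qed (use one in \<open>auto simp: min_unitization_simps min_unitization_carrier zmult_mult algebra_simps
      simp flip: zmult_simps(6)\<close>)
qed (auto simp: min_unitization_simps min_unitization_carrier algebra_simps)

lemma min_unitization_embed_simps:
  "unitization_embed x \<in> carrier min_unitization"
  "unitization_embed x \<otimes>\<^bsub>min_unitization\<^esub> unitization_embed y = unitization_embed (x * y)"
  "unitization_embed x \<oplus>\<^bsub>min_unitization\<^esub> unitization_embed y = unitization_embed (x + y)"
  "unitization_embed 0 = \<zero>\<^bsub>min_unitization\<^esub>"
  "\<ominus>\<^bsub>min_unitization\<^esub> unitization_embed x = unitization_embed (- x)"
proof -
  interpret ring min_unitization by (rule ring_min_unitization)
  show "\<ominus>\<^bsub>min_unitization\<^esub> unitization_embed x = unitization_embed (- x)"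
    by (rule minus_equality)
      (simp_all add: unitization_embed_def min_unitization_simps min_unitization_carrier)
qed (simp_all add: unitization_embed_def min_unitization_simps min_unitization_carrier)

section \<open>Conjugation in the minimal unitization\<close>

lemma square_zero_conjugate_eq:
  "square_zero_conjugate x a = unitization_embed (a + x * a - a * x - x * a * x)"
proof -
  interpret ring min_unitization by (rule ring_min_unitization)
  show ?thesis
    unfolding square_zero_conjugate_def
    by (simp add: l_distr r_distr a_minus_def min_unitization_embed_simps algebra_simps)
qed

text \<open>As x^2 = 0, the inverse of 1 + x is 1 - x.\<close>

lemma inner_automorphism_square_zero:
  assumes "square_zero x"
  shows "inner_automorphism (\<lambda>a. a + x * a - a * x - x * a * x)"
proof -
  interpret ring min_unitization by (rule ring_min_unitization)
  let ?v = "\<one>\<^bsub>min_unitization\<^esub> \<oplus>\<^bsub>min_unitization\<^esub> unitization_embed x"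
  let ?w = "\<one>\<^bsub>min_unitization\<^esub> \<ominus>\<^bsub>min_unitization\<^esub> unitization_embed x"
  have x: "unitization_embed x \<in> carrier min_unitization"
    by (rule min_unitization_embed_simps)
  have sq: "unitization_embed x \<otimes>\<^bsub>min_unitization\<^esub> unitization_embed x = \<zero>\<^bsub>min_unitization\<^esub>"
    using assms by (simp add: min_unitization_embed_simps square_zero_def)
  have "?v \<otimes>\<^bsub>min_unitization\<^esub> ?w = \<one>\<^bsub>min_unitization\<^esub>" "?w \<otimes>\<^bsub>min_unitization\<^esub> ?v = \<one>\<^bsub>min_unitization\<^esub>"
    using x by (simp_all add: a_minus_def l_distr r_distr l_minus r_minus sq a_assoc r_neg l_neg)
  moreover have "?v \<in> carrier min_unitization" "?w \<in> carrier min_unitization"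
    using x by simp_all
  ultimately have "?v \<in> Units min_unitization" "inv\<^bsub>min_unitization\<^esub> ?v = ?w"
    using inv_unique'[of ?v ?w] by (auto simp: Units_def)
  then show ?thesis
    unfolding inner_automorphism_def
    by (intro bexI[of _ ?v]) (simp_all add: square_zero_conjugate_eq flip: square_zero_conjugate_def)
qed

text \<open>b = va lies in A. Writing the inverse of v as (n,z), the integer part n acts on b
  equally from both sides, so \<alpha>(a) - a = [b,z] is a commutator within A.\<close>

lemma inner_automorphism_diff_commutator:
  assumes "inner_automorphism \<alpha>"
  shows "\<exists>x y. \<alpha> a - a = commutator x y"
proof -
  interpret ring "min_unitization :: (int \<times> 'a) ring" by (rule ring_min_unitization)
  obtain v :: "int \<times> 'a" where v: "v \<in> Units min_unitization"
    and \<alpha>: "unitization_embed (\<alpha> a) =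
      v \<otimes>\<^bsub>min_unitization\<^esub> unitization_embed a \<otimes>\<^bsub>min_unitization\<^esub> inv\<^bsub>min_unitization\<^esub> v"
    using assms unfolding inner_automorphism_def by blast
  obtain m y n z where my: "v = (m, y)" and nz: "inv\<^bsub>min_unitization\<^esub> v = (n, z)"
    by (metis surj_pair)
  define b where "b = zmult m a + y * a"
  have b: "v \<otimes>\<^bsub>min_unitization\<^esub> unitization_embed a = unitization_embed b"
    by (simp add: my unitization_embed_def min_unitization_simps b_def)
  have "unitization_embed a =
      inv\<^bsub>min_unitization\<^esub> v \<otimes>\<^bsub>min_unitization\<^esub> (v \<otimes>\<^bsub>min_unitization\<^esub> unitization_embed a)"
    using v by (simp add: min_unitization_embed_simps Units_closed Units_inv_closed flip: m_assoc)
  also have "\<dots> = unitization_embed (zmult n b + z * b)"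
    unfolding b nz by (simp add: unitization_embed_def min_unitization_simps)
  finally have "a = zmult n b + z * b" by (simp add: unitization_embed_def)
  moreover have "\<alpha> a = zmult n b + b * z"
    using \<alpha> unfolding b nz by (simp add: unitization_embed_def min_unitization_simps)
  ultimately have "\<alpha> a - a = commutator b z"
    by (simp add: commutator_def)
  then show ?thesis by blast
qed

lemma commutator_submodule_if_square_zero_invariant:
  fixes scale :: "'f::field \<Rightarrow> 'a::ring \<Rightarrow> 'a"
  assumes algebra: "algebra_over_field scale"
    and field_size: "(UNIV :: 'f set) \<noteq> {0, 1}"
    and commutators: "\<And>x y :: 'a. \<exists>zs. (\<forall>z\<in>set zs. square_zero z) \<and> commutator x y = sum_list zs"
    and subspace: "module.subspace scale V"
    and invariant: "square_zero_invariant V"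
  shows "commutator_submodule V"
proof -
  interpret algebra_over_field scale by (rule algebra)
  obtain c :: 'f where c: "c \<noteq> 0" "c \<noteq> 1" using field_size by auto
  have square_zero: "commutator x a \<in> V" if x: "square_zero x" and a: "a \<in> V" for x a
  proof -
    have *: "y * a - a * y - y * a * y \<in> V" if "square_zero y" for y
    proof -
      have "unitization_embed (a + y * a - a * y - y * a * y) \<in> unitization_embed ` V"
        using invariant that a by (simp add: square_zero_invariant_def flip: square_zero_conjugate_eq)
      then have "a + y * a - a * y - y * a * y \<in> V"
        by (auto simp: unitization_embed_def)
      then have "a + y * a - a * y - y * a * y - a \<in> V"
        by (rule subspace_diff[OF subspace _ a])
      then show ?thesis by simp
    qed
    \<comment> \<open>Conjugation by 1 + x adds p - q to a, and conjugation by 1 + cx adds cp - c^2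
      q. Eliminating p leaves (c^2 - c)q, where c^2 - c \<noteq> 0 because c is neither 0 nor
      1.\<close>
    define p q where "p = x * a - a * x" and "q = x * a * x"
    have pq: "p - q \<in> V" using *[OF x] by (simp add: p_def q_def)
    have "square_zero (scale c x)"
      using x by (simp add: square_zero_def scale_mult_left scale_mult_right)
    from *[OF this] have "scale c p - scale (c * c) q \<in> V"
      by (simp add: p_def q_def scale_mult_left scale_mult_right scale_right_diff_distrib)
    from subspace_diff[OF subspace subspace_scale[OF subspace pq, of c] this]
    have "scale (c * c - c) q \<in> V"
      by (simp add: scale_right_diff_distrib scale_left_diff_distrib)
    then have "scale (inverse (c * c - c)) (scale (c * c - c) q) \<in> V"
      by (rule subspace_scale[OF subspace])
    moreover have "c * c - c \<noteq> 0" using c by simp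
    ultimately have "q \<in> V" by simp
    then have "p - q + q \<in> V" using subspace_add[OF subspace pq] by blast
    then show ?thesis by (simp add: p_def commutator_def)
  qed
  have sum: "commutator (sum_list zs) a \<in> V" if "\<forall>z\<in>set zs. square_zero z" "a \<in> V" for zs a
    using that(1) by (induction zs)
      (auto simp: commutator_add_left subspace_0[OF subspace] intro!: subspace_add[OF subspace] square_zero that(2))
  show ?thesis
    unfolding commutator_submodule_iff
  proof (intro conjI ballI allI)
    fix x y v :: 'a assume "v \<in> V"
    then show "commutator (commutator x y) v \<in> V"
      using commutators[of x y] sum by metis
  qed (use subspace_0[OF subspace] subspace_diff[OF subspace] in auto)
qed

theorem theorem2:
  fixes scale :: "'f::field \<Rightarrow> 'a::ring \<Rightarrow> 'a"
    and V :: "'a set"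
  assumes algebra: "algebra_over_field scale"
    and field_size: "(UNIV :: 'f set) \<noteq> {0, 1}"
    and commutators: "\<And>x y :: 'a. \<exists>zs. (\<forall>z\<in>set zs. square_zero z) \<and> commutator x y = sum_list zs"
    and proper_ideals: "\<And>I :: 'a set. proper_ideal univ_ring I \<Longrightarrow>
      \<exists>P. nonexceptional_prime_ideal P \<and> I \<subseteq> P"
    and subspace: "module.subspace scale V"
    and noncentral: "fully_noncentral V"
  shows "(inner_invariant V \<longleftrightarrow> square_zero_invariant V) \<and>
         (square_zero_invariant V \<longleftrightarrow> commutator_subgroup UNIV UNIV \<subseteq> V) \<and>
         (commutator_subgroup UNIV UNIV \<subseteq> V \<longleftrightarrow> lie_ideal V) \<and>
         (lie_ideal V \<longleftrightarrow> commutator_submodule V)"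
proof -
  interpret algebra_over_field scale by (rule algebra)
  have V: "0 \<in> V" "\<And>x y. x \<in> V \<Longrightarrow> y \<in> V \<Longrightarrow> x - y \<in> V"
    using subspace_0[OF subspace] subspace_diff[OF subspace] by blast+
  have commutators_iff: "commutator_subgroup UNIV UNIV \<subseteq> V \<longleftrightarrow> (\<forall>x y. commutator x y \<in> V)"
    using commutator_subgroup_subset_iff[of V UNIV UNIV] V by simp
  have lie_iff: "lie_ideal V \<longleftrightarrow> (\<forall>x. \<forall>v\<in>V. commutator x v \<in> V)"
    using commutator_subgroup_subset_iff[of V UNIV V] V
    by (simp add: lie_ideal_def additive_subgroup_univ_ring_iff)
  \<comment> \<open>Facts 1 to 4 form a cycle through all conditions except
    \<open>lie_ideal V\<close>, which 5 and 6 place between [A,A] \<subseteq> V and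
    \<open>commutator_submodule V\<close>.\<close>
  have 1: "square_zero_invariant V" if "inner_invariant V"
    unfolding square_zero_invariant_def square_zero_conjugate_eq
  proof (intro allI impI ballI imageI)
    fix x a :: 'a assume "square_zero x" and a: "a \<in> V"
    then have "invariant_under (\<lambda>a. a + x * a - a * x - x * a * x) V"
      using that inner_automorphism_square_zero unfolding inner_invariant_def by blast
    from this[unfolded invariant_under_def image_subset_iff] a
    show "a + x * a - a * x - x * a * x \<in> V" by blast
  qed
  have 2: "commutator_submodule V" if "square_zero_invariant V"
    by (rule commutator_submodule_if_square_zero_invariant[OF algebra field_size commutators subspace that])
  have 3: "commutator_subgroup UNIV UNIV \<subseteq> V" if "commutator_submodule V"
    unfolding commutators_iff
    using commutators_mem_if_commutator_submodule[OF that proper_ideals noncentral] by blast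
  have 4: "inner_invariant V" if "commutator_subgroup UNIV UNIV \<subseteq> V"
    unfolding inner_invariant_def invariant_under_def
  proof (intro allI impI image_subsetI)
    fix \<alpha> :: "'a \<Rightarrow> 'a" and a assume \<alpha>: "inner_automorphism \<alpha>" and a: "a \<in> V"
    have "\<alpha> a - a \<in> V"
      using inner_automorphism_diff_commutator[OF \<alpha>, of a] that unfolding commutators_iff by metis
    from subspace_add[OF subspace this a] show "\<alpha> a \<in> V" by simp
  qed
  have 5: "lie_ideal V" if "commutator_subgroup UNIV UNIV \<subseteq> V"
    using that unfolding commutators_iff lie_iff by blast
  have 6: "commutator_submodule V" if "lie_ideal V"
    using that V unfolding lie_iff commutator_submodule_iff by blast
  show ?thesis using 1 2 3 4 5 6 by blast
qed

end
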